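(* Let $A$ be a bialgebra over a field $k$ with a skew antipode (for example, a Hopf algebra with bijective antipode). For left-right Hopf modules $M,N$ over $A$ let $H^*(M,N)$ be the cohomology of the total complex of the double complex $(C^{n,p}(M,N),d_m^{n,p},d_c^{n,p})_{n,p\ge 0}$ defined in the context. Then for any left-right Hopf modules $M$ and $N$ over $A$ and any natural number $n\ge 1$ we have $H^n(M,N)=0$.
   Context: $k$ is a field, all linear spaces, tensor products and Homs are over $k$; $A^n$ denotes $A^{\otimes n}$ with $A^0=k$. Sweedler notation: $\Delta(a)=\sum a_1\otimes a_2$, iterated $\sum a_1\otimes\cdots\otimes a_{r}$. A skew antipode of a bialgebra $A$ is a $k$-linear map $\bar S:A\to A$ with $\sum \bar S(a_2)a_1=\varepsilon(a)1=\sum a_2\bar S(a_1)$ for all $a\in A$. A left-right Hopf module over a bialgebra $A$ is a $k$-space $M$ that is a left $A$-module ($a\otimes m\mapsto a\cdot m$) and a right $A$-comodule ($\rho_M(m)=\sum m_0\otimes m_1\in M\otimes A$) with $\sum (a\cdot m)_0\otimes (a\cdot m)_1=\sum a_1\cdot m_0\otimes a_2m_1$ for all $a\in A$, $m\in M$. $C^{n,p}(M,N)=\mathrm{Hom}(A^n\otimes M,N\otimes A^p)$ for $n,p\ge0$. For $f\in C^{n,p}(M,N)$ write $f(x)=\sum f(x)^0\otimes f(x)^1\otimes\cdots\otimes f(x)^p$ with $f(x)^0\in N$ and $f(x)^j\in A$ for $j\ge1$. Superscripts on $a^1,\dots,a^n\in A$ are indices. Maps $b_i^{n,p}:C^{n,p}\to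 C^{n+1,p}$, $0\le i\le n+1$: - $b_0^{n,p}(f)(a^1\otimes\cdots\otimes a^{n+1}\otimes m)=\sum (a^1)_1\cdot f(x)^0\otimes (a^1)_2f(x)^1\otimes\cdots\otimes(a^1)_{p+1}f(x)^p$, with $x=a^2\otimes\cdots\otimes a^{n+1}\otimes m$; - $b_i^{n,p}(f)(a^1\otimes\cdots\otimes a^{n+1}\otimes m)=f(a^1\otimes\cdots\otimes a^ia^{i+1}\otimes\cdots\otimes a^{n+1}\otimes m)$ for $1\le i\le n$; - $b_{n+1}^{n,p}(f)(a^1\otimes\cdots\otimes a^{n+1}\otimes m)=f(a^1\otimes\cdots\otimes a^n\otimes a^{n+1}\cdot m)$. Maps $c_i^{n,p}:C^{n,p}\to C^{n,p+1}$, $0\le i\le p+1$: - $c_0^{n,p}(f)(x)=\sum (f(x)^0)_0\otimes (f(x)^0)_1\otimes f(x)^1\otimes\cdots\otimes f(x)^p$; - for $1\le i\le p$, $c_i^{n,p}(f)(x)=\sum f(x)^0\otimes\cdots\otimes (f(x)^i)_1\otimes(f(x)^i)_2\otimes\cdots\otimes f(x)^p$ ($\Delta$ applied to the $i$-th $A$-factor); - $c_{p+1}^{n,p}(f)(a^1\otimes\cdots\otimes a^n\otimes m)=\sum f((a^1)_1\otimes\cdots\otimes(a^n)_1\otimes m_0)\otimes (a^1)_2\cdots(a^n)_2m_1$. (Empty products, when $n=0$, equal $1$.) $d_m^{n,p}=\sum_{i=0}^{n+1}(-1)^ib_i^{n,p}$ and $d_c^{n,p}=\sum_{i=0}^{p+1}(-1)^ic_i^{n,p}$.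 These satisfy $d_md_m=0$, $d_cd_c=0$, $d_cd_m=d_md_c$. The total complex has degree-$r$ term $\bigoplus_{n+p=r}C^{n,p}(M,N)$ and differential $d_m^{n,p}+(-1)^nd_c^{n,p}$ on $C^{n,p}(M,N)$. *)

theory Defs
  imports Complex_Main "HOL-Library.Function_Algebras"
begin

text \<open>
  Vector spaces are types of class \<^class>\<open>ab_group_add\<close> with an explicit scalar multiplication
  satisfying \<^locale>\<open>vector_space\<close>. Sums, negatives and zero of functions are pointwise.
\<close>

section \<open>Tensor spaces\<close>

text \<open>
  A map \<open>g\<close> in one argument from \<open>V\<close> and a list of \<open>p\<close> arguments from \<open>A\<close>,
  linear in each of the \<open>p + 1\<close> slots. Nothing is required on lists of another length.
\<close>

definition multilinear ::
  "('k::field \<Rightarrow> 'v::ab_group_add \<Rightarrow> 'v) \<Rightarrow> ('k \<Rightarrow> 'a::ab_group_add \<Rightarrow> 'a) \<Rightarrow>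
   ('k \<Rightarrow> 'u::ab_group_add \<Rightarrow> 'u) \<Rightarrow> nat \<Rightarrow> ('v \<Rightarrow> 'a list \<Rightarrow> 'u) \<Rightarrow> bool" where
  "multilinear sV sA sU p g \<longleftrightarrow>
     (\<forall>as. length as = p \<longrightarrow> Vector_Spaces.linear sV sU (\<lambda>v. g v as)) \<and>
     (\<forall>v as i. length as = p \<and> i < p \<longrightarrow> Vector_Spaces.linear sA sU (\<lambda>a. g v (as[i := a])))"

text \<open>
  \<open>V \<otimes> A\<^sup>p\<close> is realised inside the dual of the space of multilinear forms on
  \<open>V \<times> A\<^sup>p\<close>: the pure tensor \<open>v \<otimes> a\<^sub>1 \<otimes> \<dots> \<otimes> a\<^sub>p\<close> is evaluation at \<open>(v, a\<^sub>1, \<dots>, a\<^sub>p)\<close>,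
  and \<open>V \<otimes> A\<^sup>p\<close> is the span of the pure tensors. Over a field this has the universal
  property of the tensor product, proved as \<open>tensor_space_universal\<close> below. One type
  accommodates all \<open>p\<close>.

  The factor \<open>V\<close> may equally well be thought of as the last one: the pure tensor
  \<open>a\<^sub>1 \<otimes> \<dots> \<otimes> a\<^sub>n \<otimes> m\<close> of \<open>A\<^sup>n \<otimes> M\<close> is also written \<open>tens sM sA m [a\<^sub>1, \<dots>, a\<^sub>n]\<close>.
\<close>

type_synonym ('k, 'v, 'a) tensor = "('v \<Rightarrow> 'a list \<Rightarrow> 'k) \<Rightarrow> 'k"

definition tens ::
  "('k::field \<Rightarrow> 'v::ab_group_add \<Rightarrow> 'v) \<Rightarrow> ('k \<Rightarrow> 'a::ab_group_add \<Rightarrow> 'a) \<Rightarrow>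
   'v \<Rightarrow> 'a list \<Rightarrow> ('k, 'v, 'a) tensor" where
  "tens sV sA v as = (\<lambda>\<phi>. if multilinear sV sA (*) (length as) \<phi> then \<phi> v as else 0)"

definition tscale :: "'k::field \<Rightarrow> ('k, 'v, 'a) tensor \<Rightarrow> ('k, 'v, 'a) tensor" where
  "tscale c t = (\<lambda>\<phi>. c * t \<phi>)"

definition tensor_space ::
  "('k::field \<Rightarrow> 'v::ab_group_add \<Rightarrow> 'v) \<Rightarrow> ('k \<Rightarrow> 'a::ab_group_add \<Rightarrow> 'a) \<Rightarrow>
   nat \<Rightarrow> ('k, 'v, 'a) tensor set" where
  "tensor_space sV sA p = module.span tscale {tens sV sA v as | v as. length as = p}"

text \<open>
  Sweedler summation. For \<open>t = \<Sum> v \<otimes> a\<^sub>1 \<otimes> \<dots> \<otimes> a\<^sub>p\<close> the value of \<open>sweedler sV sA p t g\<close> is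
  \<open>\<Sum> g v [a\<^sub>1, \<dots>, a\<^sub>p]\<close>, computed from some chosen representation of \<open>t\<close> as a sum of pure tensors.
  For multilinear \<open>g\<close> the choice is irrelevant (\<open>sweedler_eq\<close> below).
\<close>

definition tens_sum ::
  "('k::field \<Rightarrow> 'v::ab_group_add \<Rightarrow> 'v) \<Rightarrow> ('k \<Rightarrow> 'a::ab_group_add \<Rightarrow> 'a) \<Rightarrow>
   nat \<Rightarrow> ('k, 'v, 'a) tensor \<Rightarrow> ('v \<times> 'a list) list \<Rightarrow> bool" where
  "tens_sum sV sA p t ws \<longleftrightarrow>
     (\<forall>(v, as) \<in> set ws. length as = p) \<and> t = (\<Sum>(v, as)\<leftarrow>ws. tens sV sA v as)"

definition sweedler ::
  "('k::field \<Rightarrow> 'v::ab_group_add \<Rightarrow> 'v) \<Rightarrow> ('k \<Rightarrow> 'a::ab_group_add \<Rightarrow> 'a) \<Rightarrow>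
   nat \<Rightarrow> ('k, 'v, 'a) tensor \<Rightarrow> ('v \<Rightarrow> 'a list \<Rightarrow> 'u::comm_monoid_add) \<Rightarrow> 'u" where
  "sweedler sV sA p t g = (\<Sum>(v, as)\<leftarrow>(SOME ws. tens_sum sV sA p t ws). g v as)"

definition sweedler2 ::
  "('k::field \<Rightarrow> 'v::ab_group_add \<Rightarrow> 'v) \<Rightarrow> ('k \<Rightarrow> 'a::ab_group_add \<Rightarrow> 'a) \<Rightarrow>
   ('k, 'v, 'a) tensor \<Rightarrow> ('v \<Rightarrow> 'a \<Rightarrow> 'u::comm_monoid_add) \<Rightarrow> 'u" where
  "sweedler2 sV sA t g = sweedler sV sA 1 t (\<lambda>v as. g v (as ! 0))"

text \<open>
  Linear maps from a subspace \<open>S\<close> to a subspace \<open>T\<close>. They are represented by functions that are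
  \<open>0\<close> off \<open>S\<close>, so that equality of linear maps is equality of functions.
\<close>

definition Hom_on ::
  "('k::field \<Rightarrow> 'x::ab_group_add \<Rightarrow> 'x) \<Rightarrow> ('k \<Rightarrow> 'y::ab_group_add \<Rightarrow> 'y) \<Rightarrow>
   'x set \<Rightarrow> 'y set \<Rightarrow> ('x \<Rightarrow> 'y) set" where
  "Hom_on sX sY S T = {f.
     (\<forall>x\<in>S. f x \<in> T) \<and>
     (\<forall>x\<in>S. \<forall>y\<in>S. f (x + y) = f x + f y) \<and>
     (\<forall>c. \<forall>x\<in>S. f (sX c x) = sY c (f x)) \<and>
     (\<forall>x. x \<notin> S \<longrightarrow> f x = 0)}"

text \<open>
  The linear map on \<open>V \<otimes> A\<^sup>p\<close> whose value on pure tensors is given by \<open>g\<close>, which is to be multilinear.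
\<close>

definition tlift ::
  "('k::field \<Rightarrow> 'v::ab_group_add \<Rightarrow> 'v) \<Rightarrow> ('k \<Rightarrow> 'a::ab_group_add \<Rightarrow> 'a) \<Rightarrow>
   nat \<Rightarrow> ('v \<Rightarrow> 'a list \<Rightarrow> 'u::comm_monoid_add) \<Rightarrow> ('k, 'v, 'a) tensor \<Rightarrow> 'u" where
  "tlift sV sA p g = (\<lambda>t. if t \<in> tensor_space sV sA p then sweedler sV sA p t g else 0)"

subsection \<open>Universal property\<close>

lemma vector_space_tscale: "vector_space (tscale :: 'k::field \<Rightarrow> ('k, 'v, 'a) tensor \<Rightarrow> _)"
  by unfold_locales (auto simp: tscale_def fun_eq_iff algebra_simps)

lemma vector_space_times: "vector_space ((*) :: 'k::field \<Rightarrow> 'k \<Rightarrow> 'k)"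
  by unfold_locales (auto simp: algebra_simps)

lemma linear_iff':
  "Vector_Spaces.linear s1 s2 f \<longleftrightarrow> vector_space s1 \<and> vector_space s2 \<and>
     (\<forall>x y. f (x + y) = f x + f y) \<and> (\<forall>c x. f (s1 c x) = s2 c (f x))"
  unfolding Vector_Spaces.linear_def module_hom_def module_hom_axioms_def
  by (auto simp: module_iff_vector_space)

lemma multilinear_tens:
  assumes "vector_space sV" "vector_space sA"
  shows "multilinear sV sA tscale p (tens sV sA)"
  unfolding multilinear_def
proof (intro conjI allI impI; (elim conjE)?)
  fix as :: "'c list" assume "length as = p"
  show "Vector_Spaces.linear sV tscale (\<lambda>v. tens sV sA v as)"
    unfolding linear_iff' using assms vector_space_tscale
    by (auto simp: tens_def tscale_def fun_eq_iff multilinear_def linear_iff')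
next
  fix v and as :: "'c list" and i assume "length as = p" "i < p"
  then show "Vector_Spaces.linear sA tscale (\<lambda>a. tens sV sA v (as[i := a]))"
    unfolding linear_iff' using assms vector_space_tscale
    by (auto simp: tens_def tscale_def fun_eq_iff multilinear_def linear_iff')
qed

lemma tens_in_tensor_space: "length as = p \<Longrightarrow> tens sV sA v as \<in> tensor_space sV sA p"
  unfolding tensor_space_def
  by (rule module.span_base) (auto simp: module_iff_vector_space vector_space_tscale)

lemma subspace_tensor_space: "module.subspace tscale (tensor_space sV sA p)"
  unfolding tensor_space_def
  by (rule module.subspace_span) (auto simp: module_iff_vector_space vector_space_tscale)

lemma tensor_space_tens_sum:
  assumes V: "vector_space sV" and A: "vector_space sA" and t: "t \<in> tensor_space sV sA p"
  shows "\<exists>ws. tens_sum sV sA p t ws"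
proof -
  interpret T: vector_space "tscale :: 'a \<Rightarrow> ('a, 'b, 'c) tensor \<Rightarrow> _" by (rule vector_space_tscale)
  from t show ?thesis unfolding tensor_space_def
  proof (induction rule: T.span_induct_alt)
    case base
    have "tens_sum sV sA p 0 []" by (simp add: tens_sum_def)
    then show ?case by blast
  next
    case (step c x y)
    then obtain v as ws where x: "x = tens sV sA v as" "length as = p" and "tens_sum sV sA p y ws"
      by blast
    moreover have "tscale c x = tens sV sA (sV c v) as"
      using multilinear_tens[OF V A, of p] x by (auto simp: multilinear_def linear_iff')
    ultimately have "tens_sum sV sA p (tscale c x + y) ((sV c v, as) # ws)"
      by (simp add: tens_sum_def)
    then show ?case by blast
  qed
qed

lemma exists_linear_form:
  assumes "vector_space sU" "u \<noteq> 0"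
  shows "\<exists>\<psi>. Vector_Spaces.linear sU (*) \<psi> \<and> \<psi> u \<noteq> 0"
proof -
  interpret vector_space_pair sU "(*)"
    using assms vector_space_times by (simp add: vector_space_pair_def)
  have "\<not> vs1.dependent {u}"
    using assms by (simp add: vs1.dependent_single)
  then obtain \<psi> where "Vector_Spaces.linear sU (*) \<psi>" "\<forall>x\<in>{u}. \<psi> x = 1"
    using linear_independent_extend[of "{u}" "\<lambda>_. 1"] by auto
  then show ?thesis by auto
qed

lemma tens_sum_unique:
  assumes g: "multilinear sV sA sU p g" and U: "vector_space sU"
    and "tens_sum sV sA p t ws" "tens_sum sV sA p t ws'"
  shows "(\<Sum>(v, as)\<leftarrow>ws. g v as) = (\<Sum>(v, as)\<leftarrow>ws'. g v as)"
proof (rule ccontr)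
  assume "\<not> ?thesis"
  then have "(\<Sum>(v, as)\<leftarrow>ws. g v as) - (\<Sum>(v, as)\<leftarrow>ws'. g v as) \<noteq> 0" by simp
  then obtain \<psi> where \<psi>: "Vector_Spaces.linear sU (*) \<psi>"
    and ne: "\<psi> ((\<Sum>(v, as)\<leftarrow>ws. g v as) - (\<Sum>(v, as)\<leftarrow>ws'. g v as)) \<noteq> 0"
    using exists_linear_form[OF U] by blast
  interpret \<psi>: Vector_Spaces.linear sU "(*)" \<psi> by (rule \<psi>)
  have ml: "multilinear sV sA (*) p (\<lambda>v as. \<psi> (g v as))"
    using g \<psi> by (auto simp: multilinear_def linear_iff')
  have eval: "t (\<lambda>v as. \<psi> (g v as)) = \<psi> (\<Sum>(v, as)\<leftarrow>xs. g v as)"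
    if "tens_sum sV sA p t xs" for xs
  proof -
    have t: "t = (\<Sum>(v, as)\<leftarrow>xs. tens sV sA v as)" and len: "\<forall>(v, as)\<in>set xs. length as = p"
      using that by (auto simp: tens_sum_def)
    have "(\<Sum>(v, as)\<leftarrow>xs. tens sV sA v as) (\<lambda>v as. \<psi> (g v as)) = \<psi> (\<Sum>(v, as)\<leftarrow>xs. g v as)"
      using len
    proof (induction xs)
      case (Cons x xs)
      then show ?case using ml by (auto simp: tens_def \<psi>.add split: prod.splits)
    qed (simp add: \<psi>.zero)
    then show ?thesis by (simp add: t)
  qed
  from eval[OF assms(3)] eval[OF assms(4)] ne show False
    by (simp add: \<psi>.diff)
qed

lemma sweedler_eq:
  assumes "multilinear sV sA sU p g" "vector_space sU" "tens_sum sV sA p t ws"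
  shows "sweedler sV sA p t g = (\<Sum>(v, as)\<leftarrow>ws. g v as)"
  unfolding sweedler_def
  by (rule tens_sum_unique[OF assms(1,2) someI[of "tens_sum sV sA p t"] assms(3)]) (rule assms(3))

theorem tensor_space_universal:
  assumes V: "vector_space sV" and A: "vector_space sA" and U: "vector_space sU"
    and g: "multilinear sV sA sU p g"
  shows "tlift sV sA p g \<in> Hom_on tscale sU (tensor_space sV sA p) UNIV"
    and "length as = p \<Longrightarrow> tlift sV sA p g (tens sV sA v as) = g v as"
    and "\<lbrakk>h \<in> Hom_on tscale sU (tensor_space sV sA p) UNIV;
          \<And>v as. length as = p \<Longrightarrow> h (tens sV sA v as) = g v as\<rbrakk> \<Longrightarrow> h = tlift sV sA p g"
proof -
  note sub = subspace_tensor_space[of sV sA p]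
  interpret T: vector_space "tscale :: 'a \<Rightarrow> ('a, 'b, 'c) tensor \<Rightarrow> _" by (rule vector_space_tscale)
  interpret U: vector_space sU by (rule U)
  have val: "tlift sV sA p g t = (\<Sum>(v, as)\<leftarrow>ws. g v as)"
    if "tens_sum sV sA p t ws" "t \<in> tensor_space sV sA p" for t ws
    using that sweedler_eq[OF g U that(1)] by (simp add: tlift_def)
  show lift: "tlift sV sA p g \<in> Hom_on tscale sU (tensor_space sV sA p) UNIV"
    unfolding Hom_on_def
  proof (intro CollectI conjI ballI allI impI)
    fix x y assume xy: "x \<in> tensor_space sV sA p" "y \<in> tensor_space sV sA p"
    obtain ws ws' where w: "tens_sum sV sA p x ws" "tens_sum sV sA p y ws'"
      using tensor_space_tens_sum[OF V A] xy by blast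
    then have "tens_sum sV sA p (x + y) (ws @ ws')" by (auto simp: tens_sum_def)
    from val[OF this] val[OF w(1)] val[OF w(2)] xy T.subspace_add[OF sub]
    show "tlift sV sA p g (x + y) = tlift sV sA p g x + tlift sV sA p g y" by simp
  next
    fix c x assume x: "x \<in> tensor_space sV sA p"
    obtain ws where w: "tens_sum sV sA p x ws"
      using tensor_space_tens_sum[OF V A x] by blast
    let ?ws = "map (\<lambda>(v, as). (sV c v, as)) ws"
    have len: "\<forall>(v, as)\<in>set ws. length as = p" and xe: "x = (\<Sum>(v, as)\<leftarrow>ws. tens sV sA v as)"
      using w by (auto simp: tens_sum_def)
    have sc: "(\<Sum>(v, as)\<leftarrow>?ws. f v as) = s c (\<Sum>(v, as)\<leftarrow>ws. f v as)"
      if "multilinear sV sA s p f" "vector_space s" for f and s :: "'a \<Rightarrow> 'e::ab_group_add \<Rightarrow> 'e"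
    proof -
      interpret s: vector_space s by (rule that(2))
      show ?thesis using len that(1)
        by (induction ws) (auto simp: multilinear_def linear_iff' s.scale_right_distrib)
    qed
    have "tens_sum sV sA p (tscale c x) ?ws"
      using len sc[OF multilinear_tens[OF V A] vector_space_tscale] xe
      by (auto simp: tens_sum_def)
    from val[OF this] val[OF w] sc[OF g U] x T.subspace_scale[OF sub]
    show "tlift sV sA p g (tscale c x) = sU c (tlift sV sA p g x)" by simp
  qed (auto simp: tlift_def)
  show "tlift sV sA p g (tens sV sA v as) = g v as" if "length as = p" for v as
    using val[of "tens sV sA v as" "[(v, as)]"] that tens_in_tensor_space[OF that, of sV sA v]
    by (simp add: tens_sum_def)
  show "h = tlift sV sA p g"
    if h: "h \<in> Hom_on tscale sU (tensor_space sV sA p) UNIV"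
      and hg: "\<And>v as. length as = p \<Longrightarrow> h (tens sV sA v as) = g v as"
  proof
    fix t show "h t = tlift sV sA p g t"
    proof (cases "t \<in> tensor_space sV sA p")
      case False with h lift show ?thesis by (auto simp: Hom_on_def)
    next
      case True
      obtain ws where w: "tens_sum sV sA p t ws"
        using tensor_space_tens_sum[OF V A True] by blast
      have h0: "h 0 = 0"
        using h T.subspace_0[OF sub] T.subspace_scale[OF sub]
        by (auto simp: Hom_on_def dest!: spec[where x = 0] bspec[where x = 0])
      have "(\<Sum>(v, as)\<leftarrow>ws. tens sV sA v as) \<in> tensor_space sV sA p \<and>
            h (\<Sum>(v, as)\<leftarrow>ws. tens sV sA v as) = (\<Sum>(v, as)\<leftarrow>ws. g v as)"
        if "\<forall>(v, as)\<in>set ws. length as = p" for ws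
        using that
      proof (induction ws)
        case Nil show ?case unfolding list.map sum_list.Nil using h0 T.subspace_0[OF sub] by blast
      next
        case (Cons w ws)
        obtain v as where w: "w = (v, as)" by (cases w)
        let ?x = "tens sV sA v as" and ?y = "\<Sum>(v, as)\<leftarrow>ws. tens sV sA v as"
        from Cons w have as: "length as = p" and y: "?y \<in> tensor_space sV sA p"
          and hy: "h ?y = (\<Sum>(v, as)\<leftarrow>ws. g v as)" by auto
        have x: "?x \<in> tensor_space sV sA p" using as by (rule tens_in_tensor_space)
        have "h (?x + ?y) = h ?x + h ?y" using h x y unfolding Hom_on_def by blast
        then have "h (?x + ?y) = g v as + (\<Sum>(v, as)\<leftarrow>ws. g v as)" by (simp only: hg[OF as] hy)
        with T.subspace_add[OF sub x y] show ?case
          unfolding w list.map sum_list.Cons prod.case by blast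
      qed
      then show ?thesis using w val[OF w True] by (auto simp: tens_sum_def)
    qed
  qed
qed

section \<open>Bialgebras and Hopf modules\<close>

text \<open>
  The comultiplication takes values in \<open>A \<otimes> A\<^sup>1\<close>, the coaction of a comodule \<open>M\<close> in \<open>M \<otimes> A\<^sup>1\<close>;
  triple tensors live in \<open>A \<otimes> A\<^sup>2\<close> and \<open>M \<otimes> A\<^sup>2\<close>. The ring structure of \<open>A\<close> comes from its type class.
\<close>

locale bialgebra = vector_space sA
  for sA :: "'k::field \<Rightarrow> 'a::ring_1 \<Rightarrow> 'a" +
  fixes \<Delta> :: "'a \<Rightarrow> ('k, 'a, 'a) tensor" and \<epsilon> :: "'a \<Rightarrow> 'k"
  assumes scale_mult_left: "sA c a * b = sA c (a * b)"
    and scale_mult_right: "a * sA c b = sA c (a * b)"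
    and comult_in: "\<Delta> a \<in> tensor_space sA sA 1"
    and comult_linear: "Vector_Spaces.linear sA tscale \<Delta>"
    and counit_linear: "Vector_Spaces.linear sA (*) \<epsilon>"
    and coassoc:
      "sweedler2 sA sA (\<Delta> a) (\<lambda>a1 a2. sweedler2 sA sA (\<Delta> a1) (\<lambda>x y. tens sA sA x [y, a2])) =
       sweedler2 sA sA (\<Delta> a) (\<lambda>a1 a2. sweedler2 sA sA (\<Delta> a2) (\<lambda>x y. tens sA sA a1 [x, y]))"
    and counit_left: "sweedler2 sA sA (\<Delta> a) (\<lambda>a1 a2. sA (\<epsilon> a1) a2) = a"
    and counit_right: "sweedler2 sA sA (\<Delta> a) (\<lambda>a1 a2. sA (\<epsilon> a2) a1) = a"
    and comult_mult:
      "\<Delta> (a * b) = sweedler2 sA sA (\<Delta> a) (\<lambda>a1 a2. sweedler2 sA sA (\<Delta> b)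
         (\<lambda>b1 b2. tens sA sA (a1 * b1) [a2 * b2]))"
    and comult_one: "\<Delta> 1 = tens sA sA 1 [1]"
    and counit_mult: "\<epsilon> (a * b) = \<epsilon> a * \<epsilon> b"
    and counit_one: "\<epsilon> 1 = 1"

definition skew_antipode ::
  "('k::field \<Rightarrow> 'a::ring_1 \<Rightarrow> 'a) \<Rightarrow> ('a \<Rightarrow> ('k, 'a, 'a) tensor) \<Rightarrow> ('a \<Rightarrow> 'k) \<Rightarrow>
   ('a \<Rightarrow> 'a) \<Rightarrow> bool" where
  "skew_antipode sA \<Delta> \<epsilon> S \<longleftrightarrow> Vector_Spaces.linear sA sA S \<and>
     (\<forall>a. sweedler2 sA sA (\<Delta> a) (\<lambda>a1 a2. S a2 * a1) = sA (\<epsilon> a) 1 \<and>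
          sweedler2 sA sA (\<Delta> a) (\<lambda>a1 a2. a2 * S a1) = sA (\<epsilon> a) 1)"

locale hopf_module = bialgebra sA \<Delta> \<epsilon>
  for sA :: "'k::field \<Rightarrow> 'a::ring_1 \<Rightarrow> 'a" and \<Delta> \<epsilon> +
  fixes sM :: "'k \<Rightarrow> 'm::ab_group_add \<Rightarrow> 'm"
    and act :: "'a \<Rightarrow> 'm \<Rightarrow> 'm"
    and \<rho> :: "'m \<Rightarrow> ('k, 'm, 'a) tensor"
  assumes act_linear_left: "Vector_Spaces.linear sA sM (\<lambda>a. act a m)"
    and act_linear_right: "Vector_Spaces.linear sM sM (act a)"
    and act_mult: "act (a * b) m = act a (act b m)"
    and act_one: "act 1 m = m"
    and coact_in: "\<rho> m \<in> tensor_space sM sA 1"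
    and coact_linear: "Vector_Spaces.linear sM tscale \<rho>"
    and coact_coassoc:
      "sweedler2 sM sA (\<rho> m) (\<lambda>m0 m1. sweedler2 sM sA (\<rho> m0) (\<lambda>x y. tens sM sA x [y, m1])) =
       sweedler2 sM sA (\<rho> m) (\<lambda>m0 m1. sweedler2 sA sA (\<Delta> m1) (\<lambda>x y. tens sM sA m0 [x, y]))"
    and coact_counit: "sweedler2 sM sA (\<rho> m) (\<lambda>m0 m1. sM (\<epsilon> m1) m0) = m"
    and hopf_compat:
      "\<rho> (act a m) = sweedler2 sA sA (\<Delta> a) (\<lambda>a1 a2. sweedler2 sM sA (\<rho> m)
         (\<lambda>m0 m1. tens sM sA (act a1 m0) [a2 * m1]))"

section \<open>The double complex and its total cohomology\<close>

definition alt :: "nat \<Rightarrow> 'x::ab_group_add \<Rightarrow> 'x" where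
  "alt i x = (if even i then x else - x)"

locale hopf_complex =
  M: hopf_module sA \<Delta> \<epsilon> sM actM \<rho>M + N: hopf_module sA \<Delta> \<epsilon> sN actN \<rho>N
  for sA :: "'k::field \<Rightarrow> 'a::ring_1 \<Rightarrow> 'a" and \<Delta> \<epsilon>
    and sM :: "'k \<Rightarrow> 'm::ab_group_add \<Rightarrow> 'm" and actM \<rho>M
    and sN :: "'k \<Rightarrow> 'n::ab_group_add \<Rightarrow> 'n" and actN \<rho>N
begin

definition C :: "nat \<Rightarrow> nat \<Rightarrow> (('k, 'm, 'a) tensor \<Rightarrow> ('k, 'n, 'a) tensor) set" where
  "C n p = Hom_on tscale tscale (tensor_space sM sA n) (tensor_space sN sA p)"

text \<open>\<open>iter_comult p a = \<Sum> a\<^sub>1 \<otimes> \<dots> \<otimes> a\<^bsub>p+1\<^esub>\<close>, an element of \<open>A \<otimes> A\<^sup>p\<close>.\<close>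

fun iter_comult :: "nat \<Rightarrow> 'a \<Rightarrow> ('k, 'a, 'a) tensor" where
  "iter_comult 0 a = tens sA sA a []"
| "iter_comult (Suc p) a = sweedler2 sA sA (\<Delta> a) (\<lambda>a1 a2.
     sweedler sA sA p (iter_comult p a2) (\<lambda>x xs. tens sA sA a1 (x # xs)))"

text \<open>
  The lists \<open>as\<close> and \<open>ys\<close> are indexed from \<open>0\<close>: the factors written \<open>a\<^sup>i\<close> and \<open>f(x)\<^sup>i\<close> with \<open>i \<ge> 1\<close>
  are \<open>as ! (i - 1)\<close> and \<open>ys ! (i - 1)\<close>, while \<open>f(x)\<^sup>0\<close> is \<open>y\<close>.
\<close>

definition b :: "nat \<Rightarrow> nat \<Rightarrow> nat \<Rightarrow> (('k, 'm, 'a) tensor \<Rightarrow> ('k, 'n, 'a) tensor) \<Rightarrow>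
    ('k, 'm, 'a) tensor \<Rightarrow> ('k, 'n, 'a) tensor" where
  "b n p i f = tlift sM sA (n + 1) (\<lambda>m as.
     if i = 0 then
       sweedler sA sA p (iter_comult p (as ! 0)) (\<lambda>x xs.
         sweedler sN sA p (f (tens sM sA m (tl as))) (\<lambda>y ys.
           tens sN sA (actN x y) (map2 (*) xs ys)))
     else if i \<le> n then
       f (tens sM sA m (take (i - 1) as @ [as ! (i - 1) * as ! i] @ drop (i + 1) as))
     else
       f (tens sM sA (actM (as ! n) m) (take n as)))"

text \<open>
  \<open>diag_sum as m h = \<Sum> h [(a\<^sup>1)\<^sub>1, \<dots>, (a\<^sup>n)\<^sub>1] m\<^sub>0 ((a\<^sup>1)\<^sub>2 \<cdots> (a\<^sup>n)\<^sub>2 m\<^sub>1)\<close> for \<open>as = [a\<^sup>1, \<dots>, a\<^sup>n]\<close>.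
\<close>

fun diag_sum :: "'a list \<Rightarrow> 'm \<Rightarrow> ('a list \<Rightarrow> 'm \<Rightarrow> 'a \<Rightarrow> ('k, 'n, 'a) tensor) \<Rightarrow> ('k, 'n, 'a) tensor"
where
  "diag_sum [] m h = sweedler2 sM sA (\<rho>M m) (\<lambda>m0 m1. h [] m0 m1)"
| "diag_sum (a # as) m h = sweedler2 sA sA (\<Delta> a) (\<lambda>a1 a2.
     diag_sum as m (\<lambda>xs m0 z. h (a1 # xs) m0 (a2 * z)))"

definition c :: "nat \<Rightarrow> nat \<Rightarrow> nat \<Rightarrow> (('k, 'm, 'a) tensor \<Rightarrow> ('k, 'n, 'a) tensor) \<Rightarrow>
    ('k, 'm, 'a) tensor \<Rightarrow> ('k, 'n, 'a) tensor" where
  "c n p i f =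
    (if i = 0 then
       (\<lambda>t. sweedler sN sA p (f t) (\<lambda>y ys.
          sweedler2 sN sA (\<rho>N y) (\<lambda>y0 y1. tens sN sA y0 (y1 # ys))))
     else if i \<le> p then
       (\<lambda>t. sweedler sN sA p (f t) (\<lambda>y ys.
          sweedler2 sA sA (\<Delta> (ys ! (i - 1))) (\<lambda>u w.
            tens sN sA y (take (i - 1) ys @ [u, w] @ drop i ys))))
     else
       tlift sM sA n (\<lambda>m as. diag_sum as m (\<lambda>xs m0 z.
          sweedler sN sA p (f (tens sM sA m0 xs)) (\<lambda>y ys. tens sN sA y (ys @ [z])))))"

definition d_m :: "nat \<Rightarrow> nat \<Rightarrow> (('k, 'm, 'a) tensor \<Rightarrow> ('k, 'n, 'a) tensor) \<Rightarrow>
    ('k, 'm, 'a) tensor \<Rightarrow> ('k, 'n, 'a) tensor" where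
  "d_m n p f = (\<Sum>i = 0..n + 1. alt i (b n p i f))"

definition d_c :: "nat \<Rightarrow> nat \<Rightarrow> (('k, 'm, 'a) tensor \<Rightarrow> ('k, 'n, 'a) tensor) \<Rightarrow>
    ('k, 'm, 'a) tensor \<Rightarrow> ('k, 'n, 'a) tensor" where
  "d_c n p f = (\<Sum>i = 0..p + 1. alt i (c n p i f))"

text \<open>
  An element of total degree \<open>r\<close> is a family \<open>F\<close> whose component \<open>F n\<close> lies in \<open>C n (r - n)\<close>
  for \<open>n \<le> r\<close>; the remaining components are \<open>0\<close>.
\<close>

definition tot :: "nat \<Rightarrow> (nat \<Rightarrow> ('k, 'm, 'a) tensor \<Rightarrow> ('k, 'n, 'a) tensor) set" where
  "tot r = {F. (\<forall>n\<le>r. F n \<in> C n (r - n)) \<and> (\<forall>n>r. F n = 0)}"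

text \<open>
  The \<open>n\<close>-th component of the differential collects \<open>d_m\<close> of \<open>F (n - 1)\<close>, of bidegree
  \<open>(n - 1, r + 1 - n)\<close>, and \<open>(-1)\<^sup>n d_c\<close> of \<open>F n\<close>, of bidegree \<open>(n, r - n)\<close>.
\<close>

definition tot_d :: "nat \<Rightarrow> (nat \<Rightarrow> ('k, 'm, 'a) tensor \<Rightarrow> ('k, 'n, 'a) tensor) \<Rightarrow>
    nat \<Rightarrow> ('k, 'm, 'a) tensor \<Rightarrow> ('k, 'n, 'a) tensor" where
  "tot_d r F = (\<lambda>n.
     (if 1 \<le> n \<and> n \<le> r + 1 then d_m (n - 1) (r + 1 - n) (F (n - 1)) else 0) +
     (if n \<le> r then alt n (d_c n (r - n) (F n)) else 0))"

definition cocycles :: "nat \<Rightarrow> (nat \<Rightarrow> ('k, 'm, 'a) tensor \<Rightarrow> ('k, 'n, 'a) tensor) set" where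
  "cocycles r = {F \<in> tot r. tot_d r F = 0}"

definition coboundaries :: "nat \<Rightarrow> (nat \<Rightarrow> ('k, 'm, 'a) tensor \<Rightarrow> ('k, 'n, 'a) tensor) set" where
  "coboundaries r = (if r = 0 then {0} else tot_d (r - 1) ` tot (r - 1))"

definition cohomology :: "nat \<Rightarrow> (nat \<Rightarrow> ('k, 'm, 'a) tensor \<Rightarrow> ('k, 'n, 'a) tensor) set set" where
  "cohomology r = (\<lambda>F. {F + G | G. G \<in> coboundaries r}) ` cocycles r"

end

end

theory Submission
  imports Defs
begin

text \<open>
  For a Hopf module \<open>M\<close> over a bialgebra with skew antipode \<open>S\<close> put \<open>P m = \<Sum> S(m\<^sub>1) \<cdot> m\<^sub>0\<close>, the projection
  onto the coinvariants. The maps \<open>m \<mapsto> \<Sum> m\<^sub>1 \<otimes> P m\<^sub>0\<close> and \<open>n \<otimes> a \<mapsto> a \<cdot> P n\<close> are Hopf module maps splitting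
  the action \<open>A \<otimes> M \<rightarrow> M\<close> and the coaction \<open>N \<rightarrow> N \<otimes> A\<close>. The first gives an extra degeneracy \<open>s\<close> with
  \<open>s d\<^sub>m = d\<^sub>m s + (-1)\<^sup>n\<close> on \<open>C\<^bsup>n+1,p\<^esup>\<close>; the second gives \<open>t\<close> commuting with \<open>d\<^sub>m\<close>, with
  \<open>t d\<^sub>c = 1 - d\<^sub>c t\<close> on \<open>C\<^bsup>n,p+1\<^esup>\<close> and \<open>t d\<^sub>c = 1 - \<omega>\<close> on \<open>C\<^bsup>n,0\<^esup>\<close>. The defect \<open>\<omega> = t c\<^sub>1\<close> commutes with
  \<open>d\<^sub>m\<close> and has values in the kernel of \<open>d\<^sub>c\<close>. Hence a cocycle \<open>(F\<^sub>n)\<close> of total degree \<open>r \<ge> 1\<close> is the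
  coboundary of \<open>((-1)\<^sup>n t F\<^sub>n)\<close> with the correction \<open>(-1)\<^sup>r \<omega> s F\<^sub>r\<close> added in bidegree \<open>(r - 1, 0)\<close>.
\<close>

text \<open>The left-right convention dictates the skew antipode: P(a \<cdot> m) contains S(a_2 m_1)
  a_1, and \<Sum> m_1 \<cdot> P m_0 contains m_2 S(m_1), both in the skew order. Neither homotopy
  contracts its direction completely: t leaves the defect \<omega> on the edge p = 0, and the
  relation for s holds only for n \<ge> 1. After subtracting the coboundary of the t-terms, all that
  remains of a cocycle is \<omega> F_r in bidegree (r, 0). Since d_m F_r = 0, the cochain s F_r is
  up to sign a preimage of F_r under d_m, but it need not lie in the kernel of d_c, so using it as
  the correction could spoil the other components. Applying \<omega> after s cures this: d_m
  \<omega> s F_r = \<omega> d_m s F_r = (-1)^r \<omega> F_r, while d_c \<omega> = 0. The origin of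
  \<omega> is the map x \<mapsto> \<Sum> x_1 \<cdot> P(f(x_0)) for the diagonal coaction on A^n
  \<otimes> M; it turns a linear map f into a colinear one, and on C^{n,0} colinear means killed by
  d_c.\<close>

section \<open>Linear and multilinear maps on tensor spaces\<close>

text \<open>
  Linearity without the vector space premises of \<^const>\<open>Vector_Spaces.linear\<close>, so that linearity of
  composite expressions is derived by introduction rules alone.
\<close>

definition lin ::
  "('k \<Rightarrow> 'x::ab_group_add \<Rightarrow> 'x) \<Rightarrow> ('k \<Rightarrow> 'y::ab_group_add \<Rightarrow> 'y) \<Rightarrow> ('x \<Rightarrow> 'y) \<Rightarrow> bool" where
  "lin s1 s2 f \<longleftrightarrow> (\<forall>x y. f (x + y) = f x + f y) \<and> (\<forall>c x. f (s1 c x) = s2 c (f x))"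

lemma linear_imp_lin: "Vector_Spaces.linear s1 s2 f \<Longrightarrow> lin s1 s2 f"
  by (simp add: lin_def linear_iff')

lemma lin_id: "lin s s (\<lambda>x. x)"
  by (simp add: lin_def)

lemma lin_comp: "lin s2 s3 g \<Longrightarrow> lin s1 s2 f \<Longrightarrow> lin s1 s3 (\<lambda>x. g (f x))"
  by (simp add: lin_def)

text \<open>Moving a map through a finite sum takes additivity alone, and only on a set that
  contains the partial sums. The set \<open>Q\<close> lets one statement serve whole types, tensor
  spaces and the cochain groups \<open>C n p\<close>.\<close>

definition additive_on :: "'x::ab_group_add set \<Rightarrow> ('x \<Rightarrow> 'y::ab_group_add) \<Rightarrow> bool" where
  "additive_on Q L \<longleftrightarrow> 0 \<in> Q \<and> (\<forall>x\<in>Q. \<forall>y\<in>Q. x + y \<in> Q \<and> L (x + y) = L x + L y)"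

lemma additive_on_0: "additive_on Q L \<Longrightarrow> L 0 = 0"
  by (metis add_0 add_cancel_right_right additive_on_def)

lemma lin_imp_additive_on: "lin s1 s2 f \<Longrightarrow> additive_on UNIV f"
  by (simp add: lin_def additive_on_def)

lemma multilinear_iff_lin:
  assumes "vector_space sV" "vector_space sA" "vector_space sU"
  shows "multilinear sV sA sU p g \<longleftrightarrow>
    (\<forall>as. length as = p \<longrightarrow> lin sV sU (\<lambda>v. g v as)) \<and>
    (\<forall>v as i. length as = p \<longrightarrow> i < p \<longrightarrow> lin sA sU (\<lambda>a. g v (as[i := a])))"
  using assms by (auto simp: multilinear_def lin_def linear_iff')

lemma multilinear_1:
  assumes "vector_space sV" "vector_space sA" "vector_space sU"
    and 1: "\<And>a. lin sV sU (\<lambda>v. g v a)" and 2: "\<And>v. lin sA sU (\<lambda>a. g v a)"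
  shows "multilinear sV sA sU 1 (\<lambda>v as. g v (as ! 0))"
  unfolding multilinear_iff_lin[OF assms(1-3)] using 1 2 by auto

lemma multilinear_2:
  assumes "vector_space sV" "vector_space sA" "vector_space sU"
    and 1: "\<And>a b. lin sV sU (\<lambda>v. g v a b)" and 2: "\<And>v b. lin sA sU (\<lambda>a. g v a b)"
    and 3: "\<And>v a. lin sA sU (\<lambda>b. g v a b)"
  shows "multilinear sV sA sU 2 (\<lambda>v as. g v (as ! 0) (as ! Suc 0))"
  unfolding multilinear_iff_lin[OF assms(1-3)] using 1 2 3 by (auto simp: less_2_cases_iff)

text \<open>Both sides are finite double sums over the two chosen representations, and these do not
  depend on \<open>g\<close>.\<close>

lemma sweedler_swap:
  fixes g :: "'v::ab_group_add \<Rightarrow> 'a::ab_group_add list \<Rightarrow> 'w::ab_group_add \<Rightarrow> 'c::ab_group_add list \<Rightarrow> 'u::comm_monoid_add"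
  shows "sweedler sV sA p t (\<lambda>v as. sweedler sW sC q u (\<lambda>w cs. g v as w cs)) =
    sweedler sW sC q u (\<lambda>w cs. sweedler sV sA p t (\<lambda>v as. g v as w cs))"
proof -
  have "(\<Sum>(v, as)\<leftarrow>xs. \<Sum>(w, cs)\<leftarrow>ys. g v as w cs) = (\<Sum>(w, cs)\<leftarrow>ys. \<Sum>(v, as)\<leftarrow>xs. g v as w cs)"
    for xs ys
    by (induction xs) (auto simp: case_prod_unfold sum_list_addf)
  then show ?thesis by (simp add: sweedler_def)
qed

lemma sweedler2_swap:
  fixes g :: "'v::ab_group_add \<Rightarrow> 'a::ab_group_add \<Rightarrow> 'w::ab_group_add \<Rightarrow> 'c::ab_group_add \<Rightarrow> 'u::comm_monoid_add"
  shows "sweedler2 sV sA t (\<lambda>v a. sweedler2 sW sC u (\<lambda>w c. g v a w c)) =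
    sweedler2 sW sC u (\<lambda>w c. sweedler2 sV sA t (\<lambda>v a. g v a w c))"
  unfolding sweedler2_def by (rule sweedler_swap)

lemma sweedler_add_fun:
  "sweedler sV sA p t (\<lambda>v as. g v as + h v as) = sweedler sV sA p t g + sweedler sV sA p t h"
  by (simp add: sweedler_def case_prod_unfold sum_list_addf)

lemma lin_sweedler_fun:
  assumes "vector_space sU" "\<And>v as. lin s sU (\<lambda>x. g x v as)"
  shows "lin s sU (\<lambda>x. sweedler sV sA p t (\<lambda>v as. g x v as))"
proof -
  interpret U: vector_space sU by fact
  have "(\<Sum>(v, as)\<leftarrow>ws. sU c (g x v as)) = sU c (\<Sum>(v, as)\<leftarrow>ws. g x v as)" for c x ws
    by (induction ws) (auto simp: U.scale_right_distrib)
  then show ?thesis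
    using assms(2) by (simp add: lin_def sweedler_def case_prod_unfold sum_list_addf)
qed

lemma lin_sweedler2_fun:
  assumes "vector_space sU" "\<And>v a. lin s sU (\<lambda>x. g x v a)"
  shows "lin s sU (\<lambda>x. sweedler2 sV sA t (\<lambda>v a. g x v a))"
  unfolding sweedler2_def by (rule lin_sweedler_fun[OF assms])

lemma tensor_space_0: "0 \<in> tensor_space sV sA p"
  by (rule module.subspace_0[OF _ subspace_tensor_space])
    (simp add: module_iff_vector_space vector_space_tscale)

lemma tensor_space_add:
  "x \<in> tensor_space sV sA p \<Longrightarrow> y \<in> tensor_space sV sA p \<Longrightarrow> x + y \<in> tensor_space sV sA p"
  by (rule module.subspace_add[OF _ subspace_tensor_space])
    (simp_all add: module_iff_vector_space vector_space_tscale)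

lemma tensor_space_scale:
  "x \<in> tensor_space sV sA p \<Longrightarrow> tscale c x \<in> tensor_space sV sA p"
  by (rule module.subspace_scale[OF _ subspace_tensor_space])
    (simp_all add: module_iff_vector_space vector_space_tscale)

context
  fixes sV :: "'k::field \<Rightarrow> 'v::ab_group_add \<Rightarrow> 'v" and sA :: "'k \<Rightarrow> 'a::ab_group_add \<Rightarrow> 'a"
  assumes V: "vector_space sV" and A: "vector_space sA"
begin

lemma tens_sum_SOME:
  assumes "t \<in> tensor_space sV sA p"
  shows "\<forall>(v, as)\<in>set (SOME ws. tens_sum sV sA p t ws). length as = p"
    and "(\<Sum>(v, as)\<leftarrow>(SOME ws. tens_sum sV sA p t ws). tens sV sA v as) = t"
  using someI_ex[OF tensor_space_tens_sum[OF V A assms]] unfolding tens_sum_def[of sV sA p t "Eps _"]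
  by auto

lemma sweedler_cong:
  assumes "t \<in> tensor_space sV sA p" "\<And>v as. length as = p \<Longrightarrow> g v as = h v as"
  shows "sweedler sV sA p t g = sweedler sV sA p t h"
  unfolding sweedler_def using tens_sum_SOME(1)[OF assms(1)] assms(2)
  by (intro arg_cong[of _ _ sum_list] map_cong) auto

text \<open>The two claims share one induction: additivity of \<open>L\<close> on \<open>Q\<close>
  applies to a partial sum only once that sum is known to lie in \<open>Q\<close>.\<close>

lemma sweedler_push_in:
  fixes L :: "'u::ab_group_add \<Rightarrow> 'w::ab_group_add"
  assumes L: "additive_on Q L" and t: "t \<in> tensor_space sV sA p"
    and g: "\<And>v as. length as = p \<Longrightarrow> g v as \<in> Q"
  shows "L (sweedler sV sA p t g) = sweedler sV sA p t (\<lambda>v as. L (g v as)) \<and> sweedler sV sA p t g \<in> Q"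
proof -
  have "L (\<Sum>(v, as)\<leftarrow>ws. g v as) = (\<Sum>(v, as)\<leftarrow>ws. L (g v as)) \<and> (\<Sum>(v, as)\<leftarrow>ws. g v as) \<in> Q"
    if "\<forall>(v, as)\<in>set ws. length as = p" for ws
    using that
  proof (induction ws)
    case Nil
    then show ?case using additive_on_0[OF L] L by (simp add: additive_on_def)
  next
    case (Cons w ws)
    then show ?case using L g by (auto simp: additive_on_def)
  qed
  then show ?thesis unfolding sweedler_def using tens_sum_SOME(1)[OF t] by blast
qed

lemmas sweedler_push = sweedler_push_in[THEN conjunct1]

lemma sweedler_in:
  assumes "t \<in> tensor_space sV sA p" "\<And>v as. length as = p \<Longrightarrow> g v as \<in> tensor_space sW sB q"
  shows "sweedler sV sA p t g \<in> tensor_space sW sB q"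
proof -
  have "additive_on (tensor_space sW sB q) (\<lambda>x. x)"
    by (simp add: additive_on_def tensor_space_0 tensor_space_add)
  from sweedler_push_in[OF this assms] show ?thesis by (rule conjunct2)
qed

lemma sweedler_push_lin:
  assumes "lin s1 s2 L" "t \<in> tensor_space sV sA p"
  shows "L (sweedler sV sA p t g) = sweedler sV sA p t (\<lambda>v as. L (g v as))"
  using sweedler_push[OF lin_imp_additive_on[OF assms(1)] assms(2)] by simp

lemma sweedler2_push_lin:
  assumes "lin s1 s2 L" "t \<in> tensor_space sV sA 1"
  shows "L (sweedler2 sV sA t g) = sweedler2 sV sA t (\<lambda>v a. L (g v a))"
  unfolding sweedler2_def by (rule sweedler_push_lin[OF assms])

lemma sweedler_tens_id:
  assumes "t \<in> tensor_space sV sA p"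
  shows "sweedler sV sA p t (tens sV sA) = t"
  unfolding sweedler_def by (rule tens_sum_SOME(2)[OF assms])

context
  fixes sU :: "'k \<Rightarrow> 'u::ab_group_add \<Rightarrow> 'u" and p g
  assumes U: "vector_space sU" and g: "multilinear sV sA sU p g"
begin

lemma tlift_in: "t \<in> tensor_space sV sA p \<Longrightarrow> tlift sV sA p g t = sweedler sV sA p t g"
  by (simp add: tlift_def)

lemma sweedler_tens: "length as = p \<Longrightarrow> sweedler sV sA p (tens sV sA v as) g = g v as"
  using tensor_space_universal(2)[OF V A U g] tens_in_tensor_space[of as p sV sA v]
  by (simp flip: tlift_in)

lemma sweedler_add:
  "x \<in> tensor_space sV sA p \<Longrightarrow> y \<in> tensor_space sV sA p \<Longrightarrow>
    sweedler sV sA p (x + y) g = sweedler sV sA p x g + sweedler sV sA p y g"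
  using tensor_space_universal(1)[OF V A U g] tensor_space_add[of x sV sA p y]
  by (simp add: Hom_on_def flip: tlift_in)

lemma sweedler_scale:
  "x \<in> tensor_space sV sA p \<Longrightarrow>
    sweedler sV sA p (tscale c x) g = sU c (sweedler sV sA p x g)"
  using tensor_space_universal(1)[OF V A U g] tensor_space_scale[of x sV sA p c]
  by (simp add: Hom_on_def flip: tlift_in)

lemma additive_on_sweedler:
  "additive_on (tensor_space sV sA p) (\<lambda>x. sweedler sV sA p x g)"
  by (simp add: additive_on_def tensor_space_0 tensor_space_add sweedler_add)

lemma lin_sweedler:
  assumes "lin s tscale t" "\<And>x. t x \<in> tensor_space sV sA p"
  shows "lin s sU (\<lambda>x. sweedler sV sA p (t x) g)"
  using assms sweedler_add sweedler_scale by (simp add: lin_def)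

end

end

lemma sweedler_sweedler:
  assumes "vector_space sV" "vector_space sA" "vector_space sU" "multilinear sV sA sU p g"
    and "vector_space sW" "vector_space sB"
    and "t \<in> tensor_space sW sB q" "\<And>v as. length as = q \<Longrightarrow> h v as \<in> tensor_space sV sA p"
  shows "sweedler sV sA p (sweedler sW sB q t h) g =
    sweedler sW sB q t (\<lambda>v as. sweedler sV sA p (h v as) g)"
  by (rule sweedler_push[OF assms(5,6) additive_on_sweedler[OF assms(1-4)] assms(7,8)])

lemma sweedler2_in:
  assumes "vector_space sV" "vector_space sA" "t \<in> tensor_space sV sA 1"
    and "\<And>v a. h v a \<in> tensor_space sW sB q"
  shows "sweedler2 sV sA t h \<in> tensor_space sW sB q"
  unfolding sweedler2_def by (rule sweedler_in[OF assms(1-3)]) (rule assms(4))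

lemma sweedler2_sweedler:
  assumes "vector_space sV" "vector_space sA" "vector_space sU" "multilinear sV sA sU p g"
    and "vector_space sW" "vector_space sB"
    and "t \<in> tensor_space sW sB 1" "\<And>v a. h v a \<in> tensor_space sV sA p"
  shows "sweedler sV sA p (sweedler2 sW sB t h) g =
    sweedler2 sW sB t (\<lambda>v a. sweedler sV sA p (h v a) g)"
  unfolding sweedler2_def by (rule sweedler_sweedler[OF assms(1-7)]) (rule assms(8))

context
  fixes sV :: "'k::field \<Rightarrow> 'v::ab_group_add \<Rightarrow> 'v" and sA :: "'k \<Rightarrow> 'a::ab_group_add \<Rightarrow> 'a"
    and sU :: "'k \<Rightarrow> 'u::ab_group_add \<Rightarrow> 'u" and g
  assumes V: "vector_space sV" and A: "vector_space sA" and U: "vector_space sU"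
    and g1: "\<And>a. lin sV sU (\<lambda>v. g v a)" and g2: "\<And>v. lin sA sU (\<lambda>a. g v a)"
begin

lemma sweedler2_tens: "sweedler2 sV sA (tens sV sA v [a]) g = g v a"
  using sweedler_tens[OF V A U multilinear_1[OF V A U g1 g2], of "[a]" v] by (simp add: sweedler2_def)

lemma lin_sweedler2:
  assumes "lin s tscale t" "\<And>x. t x \<in> tensor_space sV sA 1"
  shows "lin s sU (\<lambda>x. sweedler2 sV sA (t x) g)"
  unfolding sweedler2_def by (rule lin_sweedler[OF V A U multilinear_1[OF V A U g1 g2] assms])

lemma sweedler2_sweedler2:
  assumes "vector_space sW" "vector_space sB"
    and "t \<in> tensor_space sW sB 1" "\<And>v a. h v a \<in> tensor_space sV sA 1"
  shows "sweedler2 sV sA (sweedler2 sW sB t h) g =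
    sweedler2 sW sB t (\<lambda>v a. sweedler2 sV sA (h v a) g)"
  unfolding sweedler2_def[of sV sA]
  by (rule sweedler2_sweedler[OF V A U multilinear_1[OF V A U g1 g2] assms])

end

text \<open>Linearity on the tensor space with no condition elsewhere. Sweedler sums satisfy it,
  although they are arbitrary off the tensor space, where no representation exists to be
  chosen.\<close>

definition tlin ::
  "('k::field \<Rightarrow> 'v::ab_group_add \<Rightarrow> 'v) \<Rightarrow> ('k \<Rightarrow> 'a::ab_group_add \<Rightarrow> 'a) \<Rightarrow> nat \<Rightarrow>
   ('k \<Rightarrow> 'u::ab_group_add \<Rightarrow> 'u) \<Rightarrow> (('k, 'v, 'a) tensor \<Rightarrow> 'u) \<Rightarrow> bool" where
  "tlin sV sA p sU L \<longleftrightarrow>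
    (\<forall>x\<in>tensor_space sV sA p. \<forall>y\<in>tensor_space sV sA p. L (x + y) = L x + L y) \<and>
    (\<forall>c. \<forall>x\<in>tensor_space sV sA p. L (tscale c x) = sU c (L x))"

lemma tlin_additive_on: "tlin sV sA p sU L \<Longrightarrow> additive_on (tensor_space sV sA p) L"
  by (simp add: tlin_def additive_on_def tensor_space_0 tensor_space_add)

lemma tlin_0: "tlin sV sA p sU L \<Longrightarrow> L 0 = 0"
  by (rule additive_on_0[OF tlin_additive_on])

lemma lin_tlin:
  assumes "tlin sV sA p sU L" "lin s tscale t" "\<And>x. t x \<in> tensor_space sV sA p"
  shows "lin s sU (\<lambda>x. L (t x))"
  using assms by (simp add: lin_def tlin_def)

lemma tlin_tlin:
  assumes "tlin sW sB q sU L'" "tlin sV sA p tscale L"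
    and "\<And>x. x \<in> tensor_space sV sA p \<Longrightarrow> L x \<in> tensor_space sW sB q"
  shows "tlin sV sA p sU (\<lambda>x. L' (L x))"
  using assms by (simp add: tlin_def)

lemma tlin_sweedler:
  assumes "vector_space sV" "vector_space sA" "vector_space sU" "multilinear sV sA sU p g"
  shows "tlin sV sA p sU (\<lambda>x. sweedler sV sA p x g)"
  by (simp add: tlin_def sweedler_add[OF assms] sweedler_scale[OF assms])

lemma tlin_sweedler_fun:
  assumes "vector_space sW" "vector_space sB" "vector_space sU" "t \<in> tensor_space sW sB q"
    and "\<And>v as. length as = q \<Longrightarrow> tlin sV sA p sU (L v as)"
  shows "tlin sV sA p sU (\<lambda>x. sweedler sW sB q t (\<lambda>v as. L v as x))"
proof -
  interpret U: vector_space sU by fact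
  have "additive_on UNIV (sU c)" for c
    by (simp add: additive_on_def U.scale_right_distrib)
  note * = sweedler_push[OF assms(1,2) this assms(4)]
  show ?thesis
    using assms(5) unfolding tlin_def
    by (auto simp: * simp flip: sweedler_add_fun intro!: sweedler_cong[OF assms(1,2,4)])
qed

lemma tlin_sweedler2_fun:
  assumes "vector_space sW" "vector_space sB" "vector_space sU" "t \<in> tensor_space sW sB 1"
    and "\<And>v a. tlin sV sA p sU (L v a)"
  shows "tlin sV sA p sU (\<lambda>x. sweedler2 sW sB t (\<lambda>v a. L v a x))"
  unfolding sweedler2_def by (rule tlin_sweedler_fun[OF assms(1-4)]) (rule assms(5))

text \<open>A variant of \<open>lin_sweedler_fun\<close> asking for linearity only at lists of
  length \<open>q\<close>. It relies on \<open>t\<close> lying in the tensor space, so that the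
  chosen representation consists of such lists. Entrywise products of lists are well behaved only
  for equal lengths.\<close>

lemma lin_sweedler_fun_len:
  assumes "vector_space sW" "vector_space sB" "vector_space sU" "t \<in> tensor_space sW sB q"
    and "\<And>v as. length as = q \<Longrightarrow> lin s sU (L v as)"
  shows "lin s sU (\<lambda>x. sweedler sW sB q t (\<lambda>v as. L v as x))"
proof -
  interpret U: vector_space sU by fact
  have "additive_on UNIV (sU c)" for c
    by (simp add: additive_on_def U.scale_right_distrib)
  note * = sweedler_push[OF assms(1,2) this assms(4)]
  show ?thesis
    using assms(5) unfolding lin_def
    by (auto simp: * simp flip: sweedler_add_fun intro!: sweedler_cong[OF assms(1,2,4)])
qed

text \<open>Every element of the tensor space is a sum of pure tensors. Most operator identities
  below are reduced by this to a computation on pure tensors.\<close>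

lemma tlin_eqI:
  assumes "vector_space sV" "vector_space sA" "tlin sV sA p sU L" "tlin sV sA p sU' L'"
    and t: "t \<in> tensor_space sV sA p"
    and eq: "\<And>v as. length as = p \<Longrightarrow> L (tens sV sA v as) = L' (tens sV sA v as)"
  shows "L t = L' t"
proof -
  have *: "L (sweedler sV sA p t (tens sV sA)) = sweedler sV sA p t (\<lambda>v as. L (tens sV sA v as))"
    if "tlin sV sA p sU L" for L and sU :: "'a \<Rightarrow> 'd::ab_group_add \<Rightarrow> 'd"
    by (rule sweedler_push[OF assms(1,2) tlin_additive_on[OF that] t tens_in_tensor_space])
  from sweedler_cong[OF assms(1,2) t eq] show ?thesis
    using *[OF assms(3)] *[OF assms(4)] sweedler_tens_id[OF assms(1,2) t] by simp
qed

lemma lin_tens: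
  assumes "vector_space sV" "vector_space sA" "lin s sV f"
  shows "lin s tscale (\<lambda>x. tens sV sA (f x) as)"
  using multilinear_tens[OF assms(1,2), of "length as"] assms(3)
  by (simp add: multilinear_iff_lin[OF assms(1,2) vector_space_tscale] lin_def)

lemma lin_tens_update:
  assumes "vector_space sV" "vector_space sA" "lin s sA f" "i < length as"
  shows "lin s tscale (\<lambda>x. tens sV sA v (as[i := f x]))"
  using multilinear_tens[OF assms(1,2), of "length as"] assms(3,4)
  by (simp add: multilinear_iff_lin[OF assms(1,2) vector_space_tscale] lin_def)

lemma lin_tens_append:
  assumes "vector_space sV" "vector_space sA" "lin s sA f"
  shows "lin s tscale (\<lambda>x. tens sV sA v (xs @ f x # ys))"
  using lin_tens_update[OF assms, of "length xs" "xs @ 0 # ys"] by simp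

lemma lin_tens_Cons:
  assumes "vector_space sV" "vector_space sA" "lin s sA f"
  shows "lin s tscale (\<lambda>x. tens sV sA v (f x # ys))"
  using lin_tens_append[OF assms, of _ "[]"] by simp

section \<open>The projection onto the coinvariants of a Hopf module\<close>

context bialgebra
begin

lemma vsA: "vector_space sA"
  by (rule vector_space_axioms)

lemma lin_mult_left: "lin s sA f \<Longrightarrow> lin s sA (\<lambda>x. f x * a)"
  by (simp add: lin_def scale_mult_left distrib_right)

lemma lin_mult_right: "lin s sA f \<Longrightarrow> lin s sA (\<lambda>x. a * f x)"
  by (simp add: lin_def scale_mult_right distrib_left)

lemmas lin_comult = linear_imp_lin[OF comult_linear]

lemma lin_sweedler2_comult:
  assumes "vector_space sU" "\<And>y. lin sA sU (\<lambda>x. g x y)" "\<And>x. lin sA sU (\<lambda>y. g x y)"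
    and "lin s sA f"
  shows "lin s sU (\<lambda>x. sweedler2 sA sA (\<Delta> (f x)) g)"
  by (rule lin_sweedler2[OF vsA vsA assms(1-3) lin_comp[OF lin_comult assms(4)] comult_in])

context
  fixes sU :: "'k \<Rightarrow> 'u::ab_group_add \<Rightarrow> 'u"
  assumes U: "vector_space sU"
begin

text \<open>The axiom is an equation in A \<otimes> A^2. Evaluating on both sides the linear map
  induced by the trilinear \<open>g\<close> turns it into an equation of sums with values in any
  vector space.\<close>

lemma sweedler2_coassoc:
  assumes g: "\<And>y z. lin sA sU (\<lambda>x. g x y z)" "\<And>x z. lin sA sU (\<lambda>y. g x y z)"
    "\<And>x y. lin sA sU (\<lambda>z. g x y z)"
  shows "sweedler2 sA sA (\<Delta> a) (\<lambda>a1 a2. sweedler2 sA sA (\<Delta> a1) (\<lambda>x y. g x y a2)) =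
    sweedler2 sA sA (\<Delta> a) (\<lambda>a1 a2. sweedler2 sA sA (\<Delta> a2) (\<lambda>x y. g a1 x y))"
proof -
  note ml = multilinear_2[OF vsA vsA U g]
  note rules = sweedler2_sweedler[OF vsA vsA U ml vsA vsA comult_in]
    sweedler2_in[OF vsA vsA comult_in] tens_in_tensor_space sweedler_tens[OF vsA vsA U ml]
  show ?thesis
    using arg_cong[OF coassoc, of "\<lambda>t. sweedler sA sA 2 t (\<lambda>v as. g v (as ! 0) (as ! Suc 0))" a]
    by (simp add: rules)
qed

lemma sweedler2_comult_mult:
  assumes g: "\<And>y. lin sA sU (\<lambda>x. g x y)" "\<And>x. lin sA sU (\<lambda>y. g x y)"
  shows "sweedler2 sA sA (\<Delta> (a * b)) (\<lambda>x y. g x y) =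
    sweedler2 sA sA (\<Delta> a) (\<lambda>a1 a2. sweedler2 sA sA (\<Delta> b) (\<lambda>b1 b2. g (a1 * b1) (a2 * b2)))"
  by (simp add: comult_mult sweedler2_sweedler2[OF vsA vsA U g vsA vsA comult_in]
    sweedler2_in[OF vsA vsA comult_in] tens_in_tensor_space sweedler2_tens[OF vsA vsA U g])

lemma sweedler2_comult_one:
  assumes g: "\<And>y. lin sA sU (\<lambda>x. g x y)" "\<And>x. lin sA sU (\<lambda>y. g x y)"
  shows "sweedler2 sA sA (\<Delta> 1) (\<lambda>x y. g x y) = g 1 1"
  by (simp add: comult_one sweedler2_tens[OF vsA vsA U g])

lemma sweedler2_counit_left:
  assumes "lin sA sU f"
  shows "sweedler2 sA sA (\<Delta> a) (\<lambda>x y. sU (\<epsilon> x) (f y)) = f a"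
  using sweedler2_push_lin[OF vsA vsA assms comult_in, of a "\<lambda>x y. sA (\<epsilon> x) y"] assms
  by (simp add: counit_left lin_def)

end

end

section \<open>Hopf module axioms in Sweedler form\<close>

context hopf_module
begin

lemma vsM: "vector_space sM"
  using coact_linear by (simp add: linear_iff')

lemmas lin_coact = linear_imp_lin[OF coact_linear]
lemmas lin_act_left = lin_comp[OF linear_imp_lin[OF act_linear_left]]
lemmas lin_act_right = lin_comp[OF linear_imp_lin[OF act_linear_right]]

lemma lin_scale_right: "lin s sM f \<Longrightarrow> lin s sM (\<lambda>x. sM k (f x))"
proof -
  interpret M: vector_space sM by (rule vsM)
  show "lin s sM f \<Longrightarrow> ?thesis" by (simp add: lin_def M.scale_right_distrib M.scale_left_commute)
qed

lemma act_scale: "act (sA k a) m = sM k (act a m)"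
  using act_linear_left by (simp add: linear_iff')

lemma lin_sweedler2_coact:
  assumes "vector_space sU" "\<And>y. lin sM sU (\<lambda>x. g x y)" "\<And>x. lin sA sU (\<lambda>y. g x y)"
    and "lin s sM f"
  shows "lin s sU (\<lambda>x. sweedler2 sM sA (\<rho> (f x)) g)"
  by (rule lin_sweedler2[OF vsM vsA assms(1-3) lin_comp[OF lin_coact assms(4)] coact_in])

context
  fixes sU :: "'k \<Rightarrow> 'u::ab_group_add \<Rightarrow> 'u"
  assumes U: "vector_space sU"
begin

lemma sweedler2_coact_coassoc:
  assumes g: "\<And>y z. lin sM sU (\<lambda>x. g x y z)" "\<And>x z. lin sA sU (\<lambda>y. g x y z)"
    "\<And>x y. lin sA sU (\<lambda>z. g x y z)"
  shows "sweedler2 sM sA (\<rho> m) (\<lambda>m0 m1. sweedler2 sM sA (\<rho> m0) (\<lambda>x y. g x y m1)) =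
    sweedler2 sM sA (\<rho> m) (\<lambda>m0 m1. sweedler2 sA sA (\<Delta> m1) (\<lambda>x y. g m0 x y))"
proof -
  note ml = multilinear_2[OF vsM vsA U g]
  note rules = sweedler2_sweedler[OF vsM vsA U ml vsM vsA coact_in]
    sweedler2_sweedler[OF vsM vsA U ml vsA vsA comult_in]
    sweedler2_in[OF vsM vsA coact_in] sweedler2_in[OF vsA vsA comult_in]
    tens_in_tensor_space sweedler_tens[OF vsM vsA U ml]
  show ?thesis
    using arg_cong[OF coact_coassoc, of "\<lambda>t. sweedler sM sA 2 t (\<lambda>v as. g v (as ! 0) (as ! Suc 0))" m]
    by (simp add: rules)
qed

lemma sweedler2_hopf_compat:
  assumes g: "\<And>y. lin sM sU (\<lambda>x. g x y)" "\<And>x. lin sA sU (\<lambda>y. g x y)"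
  shows "sweedler2 sM sA (\<rho> (act a m)) (\<lambda>x y. g x y) =
    sweedler2 sA sA (\<Delta> a) (\<lambda>a1 a2. sweedler2 sM sA (\<rho> m) (\<lambda>m0 m1. g (act a1 m0) (a2 * m1)))"
  by (simp add: hopf_compat sweedler2_sweedler2[OF vsM vsA U g vsA vsA comult_in]
    sweedler2_sweedler2[OF vsM vsA U g vsM vsA coact_in]
    sweedler2_in[OF vsM vsA coact_in] tens_in_tensor_space sweedler2_tens[OF vsM vsA U g])

end

end

section \<open>The projection P: decomposition, behaviour under the action, coinvariance of its
  values\<close>

locale skew_hopf_module = hopf_module sA \<Delta> \<epsilon> sM act \<rho>
  for sA :: "'k::field \<Rightarrow> 'a::ring_1 \<Rightarrow> 'a" and \<Delta> \<epsilon>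
    and sM :: "'k \<Rightarrow> 'm::ab_group_add \<Rightarrow> 'm" and act \<rho> +
  fixes S :: "'a \<Rightarrow> 'a"
  assumes skew: "skew_antipode sA \<Delta> \<epsilon> S"
begin

lemmas lin_S = linear_imp_lin[OF skew[unfolded skew_antipode_def, THEN conjunct1]]

lemma skew_left: "sweedler2 sA sA (\<Delta> a) (\<lambda>x y. S y * x) = sA (\<epsilon> a) 1"
  and skew_right: "sweedler2 sA sA (\<Delta> a) (\<lambda>x y. y * S x) = sA (\<epsilon> a) 1"
  using skew by (auto simp: skew_antipode_def)

definition P :: "'m \<Rightarrow> 'm" where
  "P m = sweedler2 sM sA (\<rho> m) (\<lambda>m0 m1. act (S m1) m0)"

lemma lin_P: "lin s sM f \<Longrightarrow> lin s sM (\<lambda>m. P (f m))"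
  unfolding P_def
  by (intro lin_sweedler2_coact vsM lin_act_left lin_act_right lin_S lin_id)

lemma lin_P': "lin sM sM P"
  using lin_P[OF lin_id] .

text \<open>Coassociativity rewrites the left side as \<Sum> m_2 S(m_1) \<cdot> m_0, and
  \<open>skew_right\<close> contracts the two factors from A. It yields both splittings: of the
  action on M and of the coaction on N.\<close>

lemma P_decomp: "sweedler2 sM sA (\<rho> m) (\<lambda>m0 m1. act m1 (P m0)) = m"
proof -
  have "sweedler2 sM sA (\<rho> m) (\<lambda>m0 m1. act m1 (P m0)) =
      sweedler2 sM sA (\<rho> m) (\<lambda>m0 m1. sweedler2 sM sA (\<rho> m0) (\<lambda>x y. act m1 (act (S y) x)))"
    unfolding P_def
    by (simp add: sweedler2_push_lin[OF vsM vsA linear_imp_lin[OF act_linear_right] coact_in])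
  also have "\<dots> = sweedler2 sM sA (\<rho> m) (\<lambda>m0 m1. sweedler2 sA sA (\<Delta> m1) (\<lambda>x y. act y (act (S x) m0)))"
    by (rule sweedler2_coact_coassoc[OF vsM])
      (intro lin_act_left lin_act_right lin_S lin_id)+
  also have "\<dots> = sweedler2 sM sA (\<rho> m) (\<lambda>m0 m1. act (sweedler2 sA sA (\<Delta> m1) (\<lambda>x y. y * S x)) m0)"
    by (simp add: sweedler2_push_lin[OF vsA vsA linear_imp_lin[OF act_linear_left] comult_in] act_mult)
  also have "\<dots> = m"
    by (simp add: skew_right act_scale act_one coact_counit)
  finally show ?thesis .
qed

text \<open>
  Writing \<open>m = \<Sum> m\<^sub>1 \<cdot> P m\<^sub>0\<close> first reduces this to \<open>\<Sum> S(x\<^sub>2) x\<^sub>1 = \<epsilon>(x)\<close> for \<open>x = a m\<^sub>1\<close>; the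
  antimultiplicativity of \<open>S\<close> is not needed.
\<close>

lemma P_act: "P (act a m) = sM (\<epsilon> a) (P m)"
proof -
  interpret M: vector_space sM by (rule vsM)
  note lins = vsM lin_act_left lin_act_right lin_S lin_id lin_comp[OF lin_S] lin_mult_left
    lin_mult_right lin_P lin_sweedler2_fun lin_sweedler2_coact lin_sweedler2_comult
  have "P (act a m) = sweedler2 sA sA (\<Delta> a) (\<lambda>a1 a2. sweedler2 sM sA (\<rho> m)
      (\<lambda>m0 m1. act (S (a2 * m1)) (act a1 m0)))"
    unfolding P_def by (rule sweedler2_hopf_compat[OF vsM]) (intro lins)+
  also have "\<dots> = sweedler2 sA sA (\<Delta> a) (\<lambda>a1 a2. sweedler2 sM sA (\<rho> m)
      (\<lambda>m0 m1. sweedler2 sM sA (\<rho> m0) (\<lambda>x y. act (S (a2 * m1)) (act a1 (act y (P x))))))"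
    by (simp add: P_decomp flip: sweedler2_push_lin[OF vsM vsA linear_imp_lin[OF act_linear_right] coact_in])
  also have "\<dots> = sweedler2 sA sA (\<Delta> a) (\<lambda>a1 a2. sweedler2 sM sA (\<rho> m)
      (\<lambda>m0 m1. sweedler2 sA sA (\<Delta> m1) (\<lambda>x y. act (S (a2 * y)) (act a1 (act x (P m0))))))"
    by (subst sweedler2_coact_coassoc[OF vsM]) (intro lins refl)+
  also have "\<dots> = sweedler2 sM sA (\<rho> m) (\<lambda>m0 m1. sweedler2 sA sA (\<Delta> a) (\<lambda>a1 a2.
      sweedler2 sA sA (\<Delta> m1) (\<lambda>x y. act (S (a2 * y) * (a1 * x)) (P m0))))"
    by (subst sweedler2_swap) (simp add: act_mult)
  also have "\<dots> = sweedler2 sM sA (\<rho> m) (\<lambda>m0 m1. sweedler2 sA sA (\<Delta> (a * m1)) (\<lambda>x y. act (S y * x) (P m0)))"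
    by (subst sweedler2_comult_mult[OF vsM]) (intro lins refl)+
  also have "\<dots> = sweedler2 sM sA (\<rho> m) (\<lambda>m0 m1. sM (\<epsilon> a) (P (sM (\<epsilon> m1) m0)))"
    using lin_P'
    by (simp add: M.scale_scale skew_left act_scale act_one counit_mult lin_def
      flip: sweedler2_push_lin[OF vsA vsA linear_imp_lin[OF act_linear_left] comult_in])
  also have "\<dots> = sM (\<epsilon> a) (P m)"
    using sweedler2_push_lin[OF vsM vsA lin_scale_right[OF lin_P'] coact_in, of "\<epsilon> a" m "\<lambda>m0 m1. sM (\<epsilon> m1) m0"]
    by (simp add: coact_counit)
  finally show ?thesis .
qed

text \<open>
  This says \<open>\<rho>(P m) = P m \<otimes> 1\<close>. As \<open>P\<close> kills \<open>ker \<epsilon> \<cdot> M\<close>, it holds after applying \<open>P\<close> to the left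
  factor, and \<open>v = \<Sum> v\<^sub>1 \<cdot> P v\<^sub>0\<close> recovers the general case.
\<close>

lemma P_coinvariant:
  fixes sU :: "'k \<Rightarrow> 'u::ab_group_add \<Rightarrow> 'u"
  assumes U: "vector_space sU"
    and g: "\<And>y. lin sM sU (\<lambda>x. g x y)" "\<And>x. lin sA sU (\<lambda>y. g x y)"
  shows "sweedler2 sM sA (\<rho> (P m)) (\<lambda>x y. g x y) = g (P m) 1"
proof -
  note lins = vsM U vsA lin_act_left lin_act_right lin_S lin_id lin_comp[OF lin_S] lin_mult_left
    lin_mult_right lin_P lin_sweedler2_fun lin_sweedler2_coact lin_sweedler2_comult
  have *: "sweedler2 sM sA (\<rho> (P m)) (\<lambda>x y. g (P x) y) = g (P m) 1"
    if g: "\<And>y. lin sM sU (\<lambda>x. g x y)" "\<And>x. lin sA sU (\<lambda>y. g x y)" for g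
  proof -
    note lins = lins lin_comp[OF g(1)] lin_comp[OF g(2)]
    have "sweedler2 sM sA (\<rho> (P m)) (\<lambda>x y. g (P x) y) =
        sweedler2 sM sA (\<rho> m) (\<lambda>m0 m1. sweedler2 sM sA (\<rho> (act (S m1) m0)) (\<lambda>x y. g (P x) y))"
      unfolding P_def[of m]
      by (rule sweedler2_push_lin[where ?s1.0 = sM and ?s2.0 = sU, OF vsM vsA _ coact_in]) (intro lins)
    also have "\<dots> = sweedler2 sM sA (\<rho> m) (\<lambda>m0 m1. sweedler2 sA sA (\<Delta> (S m1)) (\<lambda>a1 a2.
        sweedler2 sM sA (\<rho> m0) (\<lambda>x y. g (P (act a1 x)) (a2 * y))))"
      by (subst sweedler2_hopf_compat[OF U]) (intro lins refl)+
    \<comment> \<open>P turns the action of \<open>a1\<close> into the scalar \<epsilon>(a1), after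
      which the counit axiom collapses \<Delta>(S m_1) to S m_1.\<close>
    also have "\<dots> = sweedler2 sM sA (\<rho> m) (\<lambda>m0 m1. sweedler2 sM sA (\<rho> m0) (\<lambda>x y.
        sweedler2 sA sA (\<Delta> (S m1)) (\<lambda>a1 a2. sU (\<epsilon> a1) (g (P x) (a2 * y)))))"
      by (subst (2) sweedler2_swap) (use g in \<open>simp add: P_act lin_def\<close>)
    also have "\<dots> = sweedler2 sM sA (\<rho> m) (\<lambda>m0 m1. sweedler2 sM sA (\<rho> m0) (\<lambda>x y. g (P x) (S m1 * y)))"
      by (subst sweedler2_counit_left[OF U]) (intro lins refl)+
    also have "\<dots> = sweedler2 sM sA (\<rho> m) (\<lambda>m0 m1. sweedler2 sA sA (\<Delta> m1) (\<lambda>x y. g (P m0) (S y * x)))"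
      by (rule sweedler2_coact_coassoc[OF U]) (intro lins)+
    also have "\<dots> = sweedler2 sM sA (\<rho> m) (\<lambda>m0 m1. g (P (sM (\<epsilon> m1) m0)) 1)"
      using g lin_P' by (simp add: skew_left lin_def flip: sweedler2_push_lin[OF vsA vsA g(2) comult_in])
    also have "\<dots> = g (P m) 1"
      by (subst sweedler2_push_lin[OF vsM vsA lin_comp[OF g(1) lin_P'] coact_in, symmetric])
        (simp add: coact_counit)
    finally show ?thesis .
  qed
  note lins = lins lin_comp[OF g(1)] lin_comp[OF g(2)]
  have "sweedler2 sM sA (\<rho> (P m)) (\<lambda>x y. g x y) =
      sweedler2 sM sA (\<rho> (P m)) (\<lambda>v w. sweedler2 sM sA (\<rho> v) (\<lambda>x y. g (act y (P x)) w))"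
    by (simp add: P_decomp flip: sweedler2_push_lin[OF vsM vsA g(1) coact_in])
  also have "\<dots> = sweedler2 sM sA (\<rho> (P m)) (\<lambda>v w. sweedler2 sA sA (\<Delta> w) (\<lambda>y z. g (act y (P v)) z))"
    by (rule sweedler2_coact_coassoc[OF U]) (intro lins)+
  \<comment> \<open>The summand now sees \<open>v\<close> only through \<open>P v\<close>, so
    \<open>*\<close> applies with the bilinear map sending (v, w) to \<Sum> g (w_1 \<cdot> v)
    w_2.\<close>
  also have "\<dots> = sweedler2 sA sA (\<Delta> 1) (\<lambda>y z. g (act y (P m)) z)"
    by (rule *) (intro lins)+
  also have "\<dots> = g (P m) 1"
    by (subst sweedler2_comult_one[OF U]) (intro lins | simp add: act_one)+
  finally show ?thesis .
qed

end

section \<open>The operators of the double complex\<close>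

lemma alt_Suc: "alt (Suc i) x = - alt i x"
  by (simp add: alt_def)

lemma alt_alt: "alt i (alt i x) = x"
  by (simp add: alt_def)

lemma alt_zero: "alt i 0 = 0"
  by (simp add: alt_def)

lemma alt_plus: "alt i (x + y) = alt i x + alt i y"
  by (simp add: alt_def)

context hopf_complex
begin

section \<open>Cochain groups and additive operators between them\<close>

abbreviation "T_M n \<equiv> tensor_space sM sA n"
abbreviation "T_N p \<equiv> tensor_space sN sA p"

lemma C_iff:
  "f \<in> C n p \<longleftrightarrow> tlin sM sA n tscale f \<and> (\<forall>t\<in>T_M n. f t \<in> T_N p) \<and> (\<forall>t. t \<notin> T_M n \<longrightarrow> f t = 0)"
  by (auto simp: C_def Hom_on_def tlin_def)

lemma C_tlin: "f \<in> C n p \<Longrightarrow> tlin sM sA n tscale f"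
  by (simp add: C_iff)

lemma C_in: "f \<in> C n p \<Longrightarrow> f t \<in> T_N p"
  using tensor_space_0[of sN sA p] by (cases "t \<in> T_M n") (auto simp: C_iff)

lemma C_eqI:
  assumes "f \<in> C n p" "g \<in> C n p" "\<And>m as. length as = n \<Longrightarrow> f (tens sM sA m as) = g (tens sM sA m as)"
  shows "f = g"
proof
  fix t
  show "f t = g t"
  proof (cases "t \<in> T_M n")
    case True
    then show ?thesis
      by (rule tlin_eqI[OF M.vsM M.vsA C_tlin[OF assms(1)] C_tlin[OF assms(2)] _ assms(3)])
  next
    case False
    then show ?thesis using assms(1,2) by (simp add: C_iff)
  qed
qed

lemma lin_C_left:
  assumes "f \<in> C n p" "length as = n" "lin s sM g"
  shows "lin s tscale (\<lambda>x. f (tens sM sA (g x) as))"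
  by (rule lin_tlin[OF C_tlin[OF assms(1)] lin_tens[OF M.vsM M.vsA assms(3)]])
    (rule tens_in_tensor_space[OF assms(2)])

lemma lin_C_update:
  assumes "f \<in> C n p" "length as = n" "i < n" "lin s sA g"
  shows "lin s tscale (\<lambda>x. f (tens sM sA m (as[i := g x])))"
  by (rule lin_tlin[OF C_tlin[OF assms(1)] lin_tens_update[OF M.vsM M.vsA assms(4)]])
    (use assms(2,3) in \<open>auto intro: tens_in_tensor_space\<close>)

lemma lin_C_snoc:
  assumes "f \<in> C (Suc n) p" "length as = n" "lin s sA g"
  shows "lin s tscale (\<lambda>x. f (tens sM sA m (as @ [g x])))"
  using lin_C_update[OF assms(1) _ _ assms(3), of "as @ [0]" n] assms(2) by (simp add: list_update_append)

lemma C_tlift: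
  assumes ml: "multilinear sM sA tscale n g"
    and g: "\<And>m as. length as = n \<Longrightarrow> g m as \<in> T_N p"
  shows "tlift sM sA n g \<in> C n p"
    and "length as = n \<Longrightarrow> tlift sM sA n g (tens sM sA m as) = g m as"
  using tensor_space_universal(1,2)[OF M.vsM M.vsA vector_space_tscale ml]
    sweedler_in[OF M.vsM M.vsA _ g]
  by (auto simp: C_def Hom_on_def tlift_in[OF M.vsM M.vsA vector_space_tscale ml])

lemma C_comp:
  assumes "f \<in> C n p" "tlin sN sA p tscale L" "\<And>y. y \<in> T_N p \<Longrightarrow> L y \<in> T_N q"
  shows "(\<lambda>t. L (f t)) \<in> C n q"
  using tlin_tlin[OF assms(2) C_tlin[OF assms(1)]] assms tlin_0[OF assms(2)]
  by (auto simp: C_iff)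

lemma zero_in_C: "0 \<in> C n p"
  using tensor_space_0 by (auto simp: C_iff tlin_def tscale_def fun_eq_iff)

lemma add_in_C: "f \<in> C n p \<Longrightarrow> g \<in> C n p \<Longrightarrow> f + g \<in> C n p"
  by (auto simp: C_iff tlin_def tensor_space_add tscale_def algebra_simps fun_eq_iff)

lemma uminus_in_C: "f \<in> C n p \<Longrightarrow> - f \<in> C n p"
proof -
  have "- y = tscale (- 1) y" for y :: "('k, 'n, 'a) tensor"
    by (simp add: tscale_def fun_eq_iff)
  then show "f \<in> C n p \<Longrightarrow> - f \<in> C n p"
    by (auto simp: C_iff tlin_def tensor_space_scale) (auto simp: tscale_def fun_eq_iff algebra_simps)
qed

lemma alt_in_C: "f \<in> C n p \<Longrightarrow> alt i f \<in> C n p"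
  by (simp add: alt_def uminus_in_C)

lemma sum_in_C: "(\<And>i. i \<in> I \<Longrightarrow> f i \<in> C n p) \<Longrightarrow> sum f I \<in> C n p"
  by (induction I rule: infinite_finite_induct) (auto intro: zero_in_C add_in_C)

text \<open>Only signs occur as coefficients in the complex, so operators are recorded as additive
  maps between cochain groups.\<close>

definition cmap :: "nat \<Rightarrow> nat \<Rightarrow> nat \<Rightarrow> nat \<Rightarrow>
    ((('k, 'm, 'a) tensor \<Rightarrow> ('k, 'n, 'a) tensor) \<Rightarrow> ('k, 'm, 'a) tensor \<Rightarrow> ('k, 'n, 'a) tensor) \<Rightarrow> bool"
  where "cmap n p n' p' L \<longleftrightarrow> (\<forall>f\<in>C n p. L f \<in> C n' p') \<and> additive_on (C n p) L"

lemma cmap_in: "cmap n p n' p' L \<Longrightarrow> f \<in> C n p \<Longrightarrow> L f \<in> C n' p'"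
  by (simp add: cmap_def)

lemma cmap_add: "cmap n p n' p' L \<Longrightarrow> f \<in> C n p \<Longrightarrow> g \<in> C n p \<Longrightarrow> L (f + g) = L f + L g"
  by (simp add: cmap_def additive_on_def)

lemma cmap_0: "cmap n p n' p' L \<Longrightarrow> L 0 = 0"
  by (auto simp: cmap_def additive_on_0)

lemma cmap_uminus: "cmap n p n' p' L \<Longrightarrow> f \<in> C n p \<Longrightarrow> L (- f) = - L f"
  using cmap_add[of n p n' p' L f "- f"] cmap_0[of n p n' p' L] uminus_in_C[of f n p]
  by (simp add: eq_neg_iff_add_eq_0 add.commute)

lemma cmap_alt: "cmap n p n' p' L \<Longrightarrow> f \<in> C n p \<Longrightarrow> L (alt i f) = alt i (L f)"
  using cmap_uminus[of n p n' p' L f] by (auto simp: alt_def)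

lemma cmap_diff: "cmap n p n' p' L \<Longrightarrow> f \<in> C n p \<Longrightarrow> g \<in> C n p \<Longrightarrow> L (f - g) = L f - L g"
  using cmap_add[of n p n' p' L f "- g"] uminus_in_C[of g n p] cmap_uminus[of n p n' p' L g]
  by (metis add_uminus_conv_diff)

lemma cmap_sum: "cmap n p n' p' L \<Longrightarrow> (\<And>i. i \<in> I \<Longrightarrow> f i \<in> C n p) \<Longrightarrow> L (sum f I) = (\<Sum>i\<in>I. L (f i))"
proof (induction I rule: infinite_finite_induct)
  case (insert x F)
  have "L (f x + sum f F) = L (f x) + L (sum f F)"
    by (rule cmap_add[OF insert.prems(1)]) (auto intro: sum_in_C insert.prems(2))
  moreover have "L (sum f F) = (\<Sum>i\<in>F. L (f i))"
    by (rule insert.IH[OF insert.prems(1)]) (simp add: insert.prems(2))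
  ultimately show ?case
    by (simp only: sum.insert[OF insert.hyps])
qed (simp_all add: cmap_0[of n p n' p' L])

lemma cmap_alt_sum:
  assumes "\<And>i. i \<in> I \<Longrightarrow> cmap n p n' p' (L i)"
  shows "cmap n p n' p' (\<lambda>f. \<Sum>i\<in>I. alt i (L i f))"
proof -
  have "alt i (x + y) = alt i x + alt i y" for i and x y :: "('k, 'm, 'a) tensor \<Rightarrow> ('k, 'n, 'a) tensor"
    by (simp add: alt_def)
  then show ?thesis
    using assms
    by (auto simp: cmap_def additive_on_def zero_in_C add_in_C sum.distrib
        intro!: sum_in_C alt_in_C)
qed

lemma cmap_comp: "cmap n' p' n'' p'' L' \<Longrightarrow> cmap n p n' p' L \<Longrightarrow> cmap n p n'' p'' (\<lambda>f. L' (L f))"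
  by (simp add: cmap_def additive_on_def)

lemma cmap_tlift:
  assumes ml: "\<And>f. f \<in> C n p \<Longrightarrow> multilinear sM sA tscale n' (g f)"
    and g: "\<And>f m as. f \<in> C n p \<Longrightarrow> length as = n' \<Longrightarrow> g f m as \<in> T_N p'"
    and add: "\<And>f h m as. f \<in> C n p \<Longrightarrow> h \<in> C n p \<Longrightarrow> length as = n' \<Longrightarrow> g (f + h) m as = g f m as + g h m as"
  shows "cmap n p n' p' (\<lambda>f. tlift sM sA n' (g f))"
  unfolding cmap_def additive_on_def
proof (intro conjI ballI zero_in_C add_in_C)
  show *: "tlift sM sA n' (g f) \<in> C n' p'" if "f \<in> C n p" for f
    by (rule C_tlift(1)[OF ml[OF that] g[OF that]])
  fix f h assume fh: "f \<in> C n p" "h \<in> C n p"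
  show "tlift sM sA n' (g (f + h)) = tlift sM sA n' (g f) + tlift sM sA n' (g h)"
    by (rule C_eqI[OF *[OF add_in_C[OF fh]] add_in_C[OF *[OF fh(1)] *[OF fh(2)]]])
      (simp add: C_tlift(2)[OF ml g] fh add_in_C add)
qed

text \<open>Operators that touch only the values in N \<otimes> A^p: the c_i with i \<le> p and the
  column homotopy. Those that also change the arguments go through
  \<open>cmap_tlift\<close>.\<close>

lemma cmap_pointwise:
  assumes "tlin sN sA p tscale L" "\<And>y. y \<in> T_N p \<Longrightarrow> L y \<in> T_N q"
  shows "cmap n p n q (\<lambda>f t. L (f t))"
  unfolding cmap_def additive_on_def
  using C_comp[OF _ assms] assms(1) C_in[of _ n p]
  by (auto simp: zero_in_C add_in_C tlin_def fun_eq_iff)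

lemmas N_in = sweedler_in[OF N.vsM M.vsA]

section \<open>The diagonal action of A on N \<otimes> A^p, from which b_0 is made\<close>

lemma iter_comult_in: "iter_comult p a \<in> tensor_space sA sA p"
  by (induction p arbitrary: a)
    (auto intro!: tens_in_tensor_space sweedler2_in[OF M.vsA M.vsA M.comult_in] sweedler_in[OF M.vsA M.vsA])

lemma multilinear_tens_Cons: "multilinear sA sA tscale p (\<lambda>x xs. tens sA sA a (x # xs))"
  unfolding multilinear_iff_lin[OF M.vsA M.vsA vector_space_tscale]
proof (intro conjI allI impI)
  fix x and xs :: "'a list" and i assume "length xs = p" "i < p"
  then show "lin sA tscale (\<lambda>a'. tens sA sA a (x # xs[i := a']))"
    using lin_tens_update[OF M.vsA M.vsA lin_id, of "Suc i" "x # xs" a] by simp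
qed (intro lin_tens_Cons M.vsA lin_id)

lemma lin_iter_comult_id: "lin sA tscale (iter_comult p)"
proof (induction p)
  case 0
  show ?case unfolding iter_comult.simps by (intro lin_tens M.vsA lin_id)
next
  case (Suc p)
  have "lin sA tscale (\<lambda>a2. sweedler sA sA p (iter_comult p a2) (\<lambda>x xs. tens sA sA a1 (x # xs)))" for a1
    by (rule lin_sweedler[OF M.vsA M.vsA vector_space_tscale multilinear_tens_Cons Suc.IH iter_comult_in])
  then show ?case unfolding iter_comult.simps
    by (intro M.lin_sweedler2_comult lin_sweedler_fun lin_tens M.vsA vector_space_tscale lin_id)
qed

lemmas lin_iter_comult = lin_comp[OF lin_iter_comult_id]

definition act_T :: "nat \<Rightarrow> 'a \<Rightarrow> ('k, 'n, 'a) tensor \<Rightarrow> ('k, 'n, 'a) tensor" where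
  "act_T p a t = sweedler sA sA p (iter_comult p a) (\<lambda>x xs.
     sweedler sN sA p t (\<lambda>y ys. tens sN sA (actN x y) (map2 (*) xs ys)))"

lemma map2_update:
  "length xs = length ys \<Longrightarrow> map2 f xs (ys[i := a]) = (map2 f xs ys)[i := f (xs ! i) a]"
  "length xs = length ys \<Longrightarrow> map2 f (xs[i := u]) ys = (map2 f xs ys)[i := f u (ys ! i)]"
  using zip_update[of xs i "xs ! i" ys a] zip_update[of xs i u ys "ys ! i"]
  by (simp_all add: map_update)

lemma multilinear_act_tens:
  assumes "length xs = p"
  shows "multilinear sN sA tscale p (\<lambda>y ys. tens sN sA (actN x y) (map2 (*) xs ys))"
  unfolding multilinear_iff_lin[OF N.vsM M.vsA vector_space_tscale]
proof (intro conjI allI impI)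
  fix y and ys :: "'a list" and i assume "length ys = p" "i < p"
  then show "lin sA tscale (\<lambda>a. tens sN sA (actN x y) (map2 (*) xs (ys[i := a])))"
    using lin_tens_update[OF N.vsM M.vsA M.lin_mult_right[OF lin_id], of i "map2 (*) xs ys"] assms
    by (simp only: map2_update) simp
qed (intro lin_tens N.vsM M.vsA N.lin_act_right lin_id)

lemma multilinear_act_T:
  assumes "t \<in> T_N p"
  shows "multilinear sA sA tscale p (\<lambda>x xs. sweedler sN sA p t (\<lambda>y ys. tens sN sA (actN x y) (map2 (*) xs ys)))"
  unfolding multilinear_iff_lin[OF M.vsA M.vsA vector_space_tscale]
proof (intro conjI allI impI lin_sweedler_fun_len[OF N.vsM M.vsA vector_space_tscale assms])
  fix x y and xs ys :: "'a list" and i assume "length ys = p" "length xs = p" "i < p"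
  then show "lin sA tscale (\<lambda>a. tens sN sA (actN x y) (map2 (*) (xs[i := a]) ys))"
    using lin_tens_update[OF N.vsM M.vsA M.lin_mult_left[OF lin_id], of i "map2 (*) xs ys"]
    by (simp only: map2_update) simp
qed (intro lin_tens N.vsM M.vsA N.lin_act_left lin_id)

lemma act_T_in: "t \<in> T_N p \<Longrightarrow> act_T p a t \<in> T_N p"
  unfolding act_T_def
  by (intro sweedler_in[OF M.vsA M.vsA iter_comult_in] N_in tens_in_tensor_space) auto

lemma tlin_act_T: "tlin sN sA p tscale (act_T p a)"
  unfolding act_T_def
  by (intro tlin_sweedler_fun[OF M.vsA M.vsA vector_space_tscale iter_comult_in]
    tlin_sweedler[OF N.vsM M.vsA vector_space_tscale multilinear_act_tens])

lemma lin_act_T: "t \<in> T_N p \<Longrightarrow> lin s sA f \<Longrightarrow> lin s tscale (\<lambda>x. act_T p (f x) t)"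
  unfolding act_T_def
  by (rule lin_sweedler[OF M.vsA M.vsA vector_space_tscale multilinear_act_T lin_iter_comult iter_comult_in])

text \<open>For i \<le> p the operator c_i is postcomposition with this map. The last one, c_{p+1},
  mixes arguments and values and is treated separately through \<open>append_T\<close> and
  \<open>diag_sum\<close>.\<close>

definition coface :: "nat \<Rightarrow> nat \<Rightarrow> ('k, 'n, 'a) tensor \<Rightarrow> ('k, 'n, 'a) tensor" where
  "coface p i t = sweedler sN sA p t (\<lambda>y ys.
     if i = 0 then sweedler2 sN sA (\<rho>N y) (\<lambda>y0 y1. tens sN sA y0 (y1 # ys))
     else sweedler2 sA sA (\<Delta> (ys ! (i - 1))) (\<lambda>u w.
       tens sN sA y (take (i - 1) ys @ [u, w] @ drop i ys)))"

lemma multilinear_coface: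
  assumes "i \<le> p"
  shows "multilinear sN sA tscale p (\<lambda>y ys.
     if i = 0 then sweedler2 sN sA (\<rho>N y) (\<lambda>y0 y1. tens sN sA y0 (y1 # ys))
     else sweedler2 sA sA (\<Delta> (ys ! (i - 1))) (\<lambda>u w.
       tens sN sA y (take (i - 1) ys @ [u, w] @ drop i ys)))"
  unfolding multilinear_iff_lin[OF N.vsM M.vsA vector_space_tscale]
proof (intro conjI allI impI)
  note lins = N.vsM M.vsA vector_space_tscale lin_tens lin_tens_Cons lin_id lin_sweedler2_fun
    N.lin_sweedler2_coact
  show "lin sN tscale (\<lambda>y. if i = 0 then sweedler2 sN sA (\<rho>N y) (\<lambda>y0 y1. tens sN sA y0 (y1 # ys))
     else sweedler2 sA sA (\<Delta> (ys ! (i - 1))) (\<lambda>u w.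
       tens sN sA y (take (i - 1) ys @ [u, w] @ drop i ys)))" for ys
    by (cases "i = 0"; simp) (intro lins)+
  fix y and ys :: "'a list" and j assume ys: "length ys = p" and j: "j < p"
  note jp = ys j
  show "lin sA tscale (\<lambda>a. if i = 0 then sweedler2 sN sA (\<rho>N y) (\<lambda>y0 y1. tens sN sA y0 (y1 # ys[j := a]))
     else sweedler2 sA sA (\<Delta> (ys[j := a] ! (i - 1))) (\<lambda>u w.
       tens sN sA y (take (i - 1) (ys[j := a]) @ [u, w] @ drop i (ys[j := a]))))"
  proof (cases "i = 0")
    case True
    have "lin sA tscale (\<lambda>a. tens sN sA y0 (y1 # ys[j := a]))" for y0 y1
      using lin_tens_update[OF N.vsM M.vsA lin_id, of "Suc j" "y1 # ys" y0] jp by simp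
    with True show ?thesis by simp (intro lins)
  next
    case False
    \<comment> \<open>The factor at position i - 1 is split by \<Delta>. An updated entry before it
      keeps its place, one after it moves up by one, and an update of that factor itself enters
      through the linearity of \<Delta>.\<close>
    consider "j < i - 1" | "j = i - 1" | "i - 1 < j" by linarith
    then show ?thesis
    proof cases
      case 1
      then have "take (i - 1) (ys[j := a]) @ [u, w] @ drop i (ys[j := a]) =
          (take (i - 1) ys @ [u, w] @ drop i ys)[j := a]" for a u w
        using jp False by (simp add: take_update_swap list_update_append)
      moreover have "j < length (take (i - 1) ys @ [u, w] @ drop i ys)" for u w
        using 1 jp by simp
      ultimately show ?thesis using 1 jp False by simp (intro lins lin_tens_update; simp)
    next
      case 2
      have "lin sA tscale (\<lambda>u. tens sN sA y (take (i - 1) ys @ [u, w] @ drop i ys))" for w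
        using lin_tens_append[OF N.vsM M.vsA lin_id, where v = y and xs = "take (i - 1) ys" and ys = "w # drop i ys"] by simp
      moreover have "lin sA tscale (\<lambda>w. tens sN sA y (take (i - 1) ys @ [u, w] @ drop i ys))" for u
        using lin_tens_append[OF N.vsM M.vsA lin_id, where v = y and xs = "take (i - 1) ys @ [u]" and ys = "drop i ys"] by simp
      ultimately show ?thesis using 2 jp False assms by simp (intro M.lin_sweedler2_comult lins; simp)
    next
      case 3
      then have "take (i - 1) (ys[j := a]) @ [u, w] @ drop i (ys[j := a]) =
          (take (i - 1) ys @ [u, w] @ drop i ys)[Suc j := a]" for a u w
        using jp False by (simp add: drop_update_swap list_update_append Suc_diff_le split: nat_diff_split)
      moreover have "Suc j < length (take (i - 1) ys @ [u, w] @ drop i ys)" for u w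
        using 3 jp by simp
      ultimately show ?thesis using 3 jp False by simp (intro lins lin_tens_update; simp)
    qed
  qed
qed

lemma tlin_coface: "i \<le> p \<Longrightarrow> tlin sN sA p tscale (coface p i)"
  unfolding coface_def by (rule tlin_sweedler[OF N.vsM M.vsA vector_space_tscale multilinear_coface])

lemma coface_in: "i \<le> p \<Longrightarrow> t \<in> T_N p \<Longrightarrow> coface p i t \<in> T_N (Suc p)"
  unfolding coface_def
  by (rule N_in, assumption)
    (auto intro!: sweedler2_in[OF N.vsM M.vsA N.coact_in] sweedler2_in[OF M.vsA M.vsA M.comult_in] tens_in_tensor_space)

lemma coface_tens:
  "i \<le> p \<Longrightarrow> length ys = p \<Longrightarrow> coface p i (tens sN sA y ys) =
    (if i = 0 then sweedler2 sN sA (\<rho>N y) (\<lambda>y0 y1. tens sN sA y0 (y1 # ys))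
     else sweedler2 sA sA (\<Delta> (ys ! (i - 1))) (\<lambda>u w.
       tens sN sA y (take (i - 1) ys @ [u, w] @ drop i ys)))"
  unfolding coface_def by (rule sweedler_tens[OF N.vsM M.vsA vector_space_tscale multilinear_coface])

lemma c_eq_coface: "i \<le> p \<Longrightarrow> c n p i f = (\<lambda>t. coface p i (f t))"
  by (simp add: c_def coface_def)

lemma cmap_c:
  assumes "i \<le> p"
  shows "cmap n p n (Suc p) (c n p i)"
  using cmap_pointwise[OF tlin_coface[OF assms] coface_in[OF assms]]
  by (simp add: c_eq_coface[OF assms, abs_def])

definition append_T :: "nat \<Rightarrow> 'a \<Rightarrow> ('k, 'n, 'a) tensor \<Rightarrow> ('k, 'n, 'a) tensor" where
  "append_T p z t = sweedler sN sA p t (\<lambda>y ys. tens sN sA y (ys @ [z]))"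

lemma multilinear_append_T: "multilinear sN sA tscale p (\<lambda>y ys. tens sN sA y (ys @ [z]))"
  unfolding multilinear_iff_lin[OF N.vsM M.vsA vector_space_tscale]
proof (intro conjI allI impI)
  fix y and ys :: "'a list" and i assume "length ys = p" "i < p"
  then show "lin sA tscale (\<lambda>a. tens sN sA y (ys[i := a] @ [z]))"
    using lin_tens_update[OF N.vsM M.vsA lin_id, of i "ys @ [z]" y] by (simp add: list_update_append)
qed (intro lin_tens N.vsM M.vsA lin_id)

lemma tlin_append_T: "tlin sN sA p tscale (append_T p z)"
  unfolding append_T_def by (rule tlin_sweedler[OF N.vsM M.vsA vector_space_tscale multilinear_append_T])

lemma append_T_in: "t \<in> T_N p \<Longrightarrow> append_T p z t \<in> T_N (Suc p)"
  unfolding append_T_def by (rule N_in) (auto intro: tens_in_tensor_space)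

lemma append_T_tens: "length ys = p \<Longrightarrow> append_T p z (tens sN sA y ys) = tens sN sA y (ys @ [z])"
  unfolding append_T_def by (rule sweedler_tens[OF N.vsM M.vsA vector_space_tscale multilinear_append_T])

lemma lin_append_T: "lin s sA f \<Longrightarrow> lin s tscale (\<lambda>x. append_T p (f x) t)"
  unfolding append_T_def
  by (intro lin_sweedler_fun vector_space_tscale lin_tens_append[of sN sA, where ys = "[]"] N.vsM M.vsA)

section \<open>Sweedler sums for the diagonal coaction on A^n \<otimes> M\<close>

lemma lin_diag_sum_fun:
  "(\<And>xs m z. length xs = length as \<Longrightarrow> lin s tscale (\<lambda>x. h x xs m z)) \<Longrightarrow>
    lin s tscale (\<lambda>x. diag_sum as m (h x))"
proof (induction as arbitrary: h)
  case (Cons a as)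
  show ?case unfolding diag_sum.simps
    by (intro lin_sweedler2_fun vector_space_tscale Cons.IH) (simp add: Cons.prems)
qed (simp add: lin_sweedler2_fun vector_space_tscale)

lemma diag_sum_in:
  "(\<And>xs m z. length xs = length as \<Longrightarrow> h xs m z \<in> T_N q) \<Longrightarrow> diag_sum as m h \<in> T_N q"
proof (induction as arbitrary: h)
  case (Cons a as)
  show ?case unfolding diag_sum.simps
    by (intro sweedler2_in[OF M.vsA M.vsA M.comult_in] Cons.IH) (simp add: Cons.prems)
qed (simp add: sweedler2_in[OF M.vsM M.vsA M.coact_in])

lemma diag_sum_cong:
  "(\<And>xs m z. length xs = length as \<Longrightarrow> h xs m z = h' xs m z) \<Longrightarrow> diag_sum as m h = diag_sum as m h'"
proof (induction as arbitrary: h h')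
  case (Cons a as)
  have "diag_sum as m (\<lambda>xs m0 z. h (a1 # xs) m0 (a2 * z)) = diag_sum as m (\<lambda>xs m0 z. h' (a1 # xs) m0 (a2 * z))"
    for a1 a2 by (rule Cons.IH) (simp add: Cons.prems)
  then show ?case by simp
next
  case Nil
  from Nil[of "[]"] have "h [] = h' []" by (simp add: fun_eq_iff)
  then show ?case by simp
qed

lemma diag_sum_push:
  "tlin sN sA q tscale L \<Longrightarrow> (\<And>xs m z. length xs = length as \<Longrightarrow> h xs m z \<in> T_N q) \<Longrightarrow>
    L (diag_sum as m h) = diag_sum as m (\<lambda>xs m z. L (h xs m z))"
proof (induction as arbitrary: h)
  case Nil
  then have "h [] m z \<in> T_N q" for m z by simp
  with Nil(1) show ?case
    unfolding diag_sum.simps sweedler2_def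
    by (intro sweedler_push[OF M.vsM M.vsA tlin_additive_on M.coact_in])
next
  case (Cons a as)
  show ?case
    unfolding diag_sum.simps sweedler2_def
    by (subst Cons.IH[OF Cons.prems(1), symmetric], simp add: Cons.prems(2),
      intro sweedler_push[OF M.vsA M.vsA tlin_additive_on[OF Cons.prems(1)] M.comult_in] diag_sum_in)
      (simp add: Cons.prems(2))
qed

lemma diag_sum_add:
  "diag_sum as m (\<lambda>xs m z. h xs m z + h' xs m z) = diag_sum as m h + diag_sum as m h'"
  by (induction as arbitrary: h h') (simp_all add: sweedler2_def sweedler_add_fun)

lemma sweedler2_diag_sum_swap:
  "sweedler2 sA sA t (\<lambda>u v. diag_sum as m (h u v)) =
    diag_sum as m (\<lambda>xs m z. sweedler2 sA sA t (\<lambda>u v. h u v xs m z))"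
proof (induction as arbitrary: h)
  case Nil
  then show ?case by (simp, subst sweedler2_swap, rule refl)
next
  case (Cons a as)
  then show ?case by (simp, subst sweedler2_swap, simp)
qed

text \<open>Linearity of the summand in each of its n + 2 slots, which makes \<open>diag_sum\<close>
  multilinear in its own arguments. Only lists of length \<open>k\<close> are constrained, since
  cochains are linear only on tensors of their own degree.\<close>

definition diag_multilinear :: "nat \<Rightarrow> ('a list \<Rightarrow> 'm \<Rightarrow> 'a \<Rightarrow> ('k, 'n, 'a) tensor) \<Rightarrow> bool" where
  "diag_multilinear k h \<longleftrightarrow> (\<forall>xs. length xs = k \<longrightarrow>
    (\<forall>z. lin sM tscale (\<lambda>m. h xs m z)) \<and>
    (\<forall>m. lin sA tscale (\<lambda>z. h xs m z)) \<and>
    (\<forall>m z. \<forall>i<k. lin sA tscale (\<lambda>a. h (xs[i := a]) m z)))"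

lemma diag_multilinear_m: "diag_multilinear k h \<Longrightarrow> length xs = k \<Longrightarrow> lin sM tscale (\<lambda>m. h xs m z)"
  and diag_multilinear_z: "diag_multilinear k h \<Longrightarrow> length xs = k \<Longrightarrow> lin sA tscale (\<lambda>z. h xs m z)"
  and diag_multilinear_update: "diag_multilinear k h \<Longrightarrow> length xs = k \<Longrightarrow> i < k \<Longrightarrow> lin sA tscale (\<lambda>a. h (xs[i := a]) m z)"
  by (simp_all add: diag_multilinear_def)

lemma diag_multilinear_Cons: "diag_multilinear (Suc k) h \<Longrightarrow> length xs = k \<Longrightarrow> lin sA tscale (\<lambda>a. h (a # xs) m z)"
  using diag_multilinear_update[of "Suc k" h "0 # xs" 0 m z] by simp

text \<open>The recursion of \<open>diag_sum\<close> passes exactly this modified summand to the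
  tail, so inductions over the list of arguments need the condition to survive it.\<close>

lemma diag_multilinear_shift:
  assumes "diag_multilinear (Suc k) h"
  shows "diag_multilinear k (\<lambda>xs m z. h (a # xs) m (u * z))"
  unfolding diag_multilinear_def
proof (intro allI impI conjI)
  fix xs :: "'a list" assume xs: "length xs = k"
  show "lin sM tscale (\<lambda>m. h (a # xs) m (u * z))" for z
    by (rule diag_multilinear_m[OF assms]) (simp add: xs)
  show "lin sA tscale (\<lambda>z. h (a # xs) m (u * z))" for m
    by (rule lin_comp[OF diag_multilinear_z[OF assms] M.lin_mult_right[OF lin_id]]) (simp add: xs)
  show "lin sA tscale (\<lambda>a'. h (a # xs[i := a']) m (u * z))" if "i < k" for i m z
    using diag_multilinear_update[OF assms, of "a # xs" "Suc i" m "u * z"] xs that by simp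
qed

lemma lin_diag_sum_left: "diag_multilinear (length as) h \<Longrightarrow> lin s sM f \<Longrightarrow> lin s tscale (\<lambda>x. diag_sum as (f x) h)"
proof (induction as arbitrary: h)
  case Nil
  then show ?case unfolding diag_sum.simps
    by (intro M.lin_sweedler2_coact vector_space_tscale) (auto intro: diag_multilinear_m diag_multilinear_z)
next
  case (Cons a as)
  show ?case unfolding diag_sum.simps
    by (intro lin_sweedler2_fun vector_space_tscale Cons.IH Cons.prems(2) diag_multilinear_shift)
      (use Cons.prems(1) in simp)
qed

lemma lin_diag_sum_update:
  "diag_multilinear (length as) h \<Longrightarrow> i < length as \<Longrightarrow> lin sA tscale (\<lambda>a. diag_sum (as[i := a]) m h)"
proof (induction as arbitrary: h i)
  case (Cons u as)
  show ?case
  proof (cases i)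
    case 0
    have "lin sA tscale (\<lambda>a. diag_sum (a # as) m h)"
      unfolding diag_sum.simps
      by (intro M.lin_sweedler2_comult vector_space_tscale lin_id lin_diag_sum_fun)
       (use Cons.prems(1) in \<open>auto intro!: diag_multilinear_Cons lin_comp[OF diag_multilinear_z M.lin_mult_left[OF lin_id]]\<close>)
    then show ?thesis using 0 by simp
  next
    case (Suc j)
    have "lin sA tscale (\<lambda>a. diag_sum (u # as[j := a]) m h)"
      unfolding diag_sum.simps
      by (intro lin_sweedler2_fun vector_space_tscale Cons.IH diag_multilinear_shift)
        (use Cons.prems Suc in simp_all)
    then show ?thesis using Suc by simp
  qed
qed simp

lemma multilinear_diag_sum:
  assumes "diag_multilinear n h"
  shows "multilinear sM sA tscale n (\<lambda>m as. diag_sum as m h)"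
  unfolding multilinear_iff_lin[OF M.vsM M.vsA vector_space_tscale]
  using assms by (auto intro!: lin_diag_sum_left lin_diag_sum_update lin_id)

lemma diag_multilinear_append_T:
  assumes "f \<in> C n p"
  shows "diag_multilinear n (\<lambda>xs m0 z. append_T p z (f (tens sM sA m0 xs)))"
  unfolding diag_multilinear_def
  by (auto intro!: lin_append_T lin_id lin_tlin[OF tlin_append_T] lin_C_left[OF assms] lin_C_update[OF assms] C_in[OF assms])

lemma c_last_eq: "c n p (Suc p) f = tlift sM sA n (\<lambda>m as. diag_sum as m (\<lambda>xs m0 z.
    append_T p z (f (tens sM sA m0 xs))))"
  by (simp add: c_def append_T_def)

lemma cmap_c_last: "cmap n p n (Suc p) (c n p (Suc p))"
  unfolding c_last_eq[abs_def]
proof (rule cmap_tlift)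
  fix f assume f: "f \<in> C n p"
  show "multilinear sM sA tscale n (\<lambda>m as. diag_sum as m (\<lambda>xs m0 z. append_T p z (f (tens sM sA m0 xs))))"
    by (rule multilinear_diag_sum[OF diag_multilinear_append_T[OF f]])
  show "diag_sum as m (\<lambda>xs m0 z. append_T p z (f (tens sM sA m0 xs))) \<in> T_N (Suc p)" for m as
    by (intro diag_sum_in append_T_in C_in[OF f])
  fix h as m assume h: "h \<in> C n p"
  show "diag_sum as m (\<lambda>xs m0 z. append_T p z ((f + h) (tens sM sA m0 xs))) =
      diag_sum as m (\<lambda>xs m0 z. append_T p z (f (tens sM sA m0 xs))) +
      diag_sum as m (\<lambda>xs m0 z. append_T p z (h (tens sM sA m0 xs)))"
    using tlin_append_T[of p] C_in[OF f] C_in[OF h] by (simp add: tlin_def flip: diag_sum_add)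
qed

lemma c_last_tens:
  assumes "f \<in> C n p" "length as = n"
  shows "c n p (Suc p) f (tens sM sA m as) =
    diag_sum as m (\<lambda>xs m0 z. append_T p z (f (tens sM sA m0 xs)))"
  unfolding c_last_eq
  by (rule C_tlift(2)[OF multilinear_diag_sum[OF diag_multilinear_append_T] _ assms(2)])
    (auto intro!: assms(1) diag_sum_in append_T_in C_in[OF assms(1)])

lemma cmap_d_c: "cmap n p n (Suc p) (d_c n p)"
proof -
  have "cmap n p n (Suc p) (c n p i)" if "i \<le> Suc p" for i
    using cmap_c[of i p n] cmap_c_last[of n p] that le_Suc_eq by metis
  then show ?thesis unfolding d_c_def[abs_def] by (intro cmap_alt_sum) simp
qed

section \<open>The operators b_i; with lists counted from 0, b_i merges at position i - 1\<close>

definition merge :: "nat \<Rightarrow> 'a list \<Rightarrow> 'a list" where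
  "merge i as = take i as @ [as ! i * as ! Suc i] @ drop (i + 2) as"

definition b_body :: "nat \<Rightarrow> nat \<Rightarrow> nat \<Rightarrow> (('k, 'm, 'a) tensor \<Rightarrow> ('k, 'n, 'a) tensor) \<Rightarrow>
    'm \<Rightarrow> 'a list \<Rightarrow> ('k, 'n, 'a) tensor" where
  "b_body n p i f m as =
    (if i = 0 then act_T p (as ! 0) (f (tens sM sA m (tl as)))
     else if i \<le> n then f (tens sM sA m (merge (i - 1) as))
     else f (tens sM sA (actM (as ! n) m) (take n as)))"

lemma b_eq_tlift: "b n p i f = tlift sM sA (Suc n) (b_body n p i f)"
  unfolding b_def Suc_eq_plus1[symmetric]
  by (intro arg_cong[where f = "tlift sM sA (Suc n)"] ext) (auto simp: b_body_def act_T_def merge_def)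

lemma multilinear_b_body:
  assumes f: "f \<in> C n p"
  shows "multilinear sM sA tscale (Suc n) (b_body n p i f)"
  unfolding multilinear_iff_lin[OF M.vsM M.vsA vector_space_tscale]
proof (intro conjI allI impI)
  fix as :: "'a list" assume as: "length as = Suc n"
  show "lin sM tscale (\<lambda>m. b_body n p i f m as)"
  proof (cases "i = 0")
    case True
    have "lin sM tscale (\<lambda>m. act_T p (as ! 0) (f (tens sM sA m (tl as))))"
      by (rule lin_tlin[OF tlin_act_T lin_C_left[OF f _ lin_id] C_in[OF f]]) (simp add: as)
    with True show ?thesis by (simp add: b_body_def)
  next
    case False
    with as show ?thesis
      by (cases "i \<le> n") (auto simp: b_body_def merge_def intro!: lin_C_left[OF f] lin_id M.lin_act_right)
  qed
  fix m j assume j: "j < Suc n"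
  consider "i = 0" "j = 0" | j' where "i = 0" "j = Suc j'" | "0 < i" "i \<le> n" | "n < i" "j < n" | "n < i" "j = n"
    using j by (metis gr0_conv_Suc less_antisym linorder_not_less neq0_conv)
  then show "lin sA tscale (\<lambda>a. b_body n p i f m (as[j := a]))"
  proof cases
    case 1
    have "tl (as[0 := a]) = tl as" for a by (cases as) auto
    with 1 as show ?thesis
      by (auto simp: b_body_def intro!: lin_act_T lin_id C_in[OF f])
  next
    case (2 j')
    have "tl (as[Suc j' := a]) = (tl as)[j' := a]" "as[Suc j' := a] ! 0 = as ! 0" for a
      using as by (cases as; auto)+
    with 2 as j show ?thesis
      by (auto simp: b_body_def intro!: lin_tlin[OF tlin_act_T] lin_C_update[OF f] lin_id C_in[OF f])
  next
    case 3
    note mid = 3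
    have len: "length (merge (i - 1) as) = n" using mid as by (simp add: merge_def)
    \<comment> \<open>Updating one entry before merging amounts to updating one entry of the merged
      list by a linear function: the identity away from the product, and left or right
      multiplication by the other factor inside it.\<close>
    have "\<exists>k<n. \<exists>g. lin sA sA g \<and> (\<forall>a. merge (i - 1) (as[j := a]) = (merge (i - 1) as)[k := g a])"
    proof -
      consider "j < i - 1" | "j = i - 1" | "j = i" | "i < j" using mid by linarith
      then show ?thesis
      proof cases
        case 1
        then have "merge (i - 1) (as[j := a]) = (merge (i - 1) as)[j := a]" for a
          using as mid by (simp add: merge_def take_update_swap list_update_append)
        with 1 mid show ?thesis by (intro exI[of _ j] exI[of _ "\<lambda>a. a"]) (auto intro: lin_id)
      next
        case 2
        then have "merge (i - 1) (as[j := a]) = (merge (i - 1) as)[i - 1 := a * as ! i]" for a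
          using as mid by (simp add: merge_def list_update_append)
        with mid show ?thesis
          by (intro exI[of _ "i - 1"] exI[of _ "\<lambda>a. a * as ! i"]) (auto intro: lin_id M.lin_mult_left)
      next
        case 3
        then have "merge (i - 1) (as[j := a]) = (merge (i - 1) as)[i - 1 := as ! (i - 1) * a]" for a
          using as mid by (simp add: merge_def list_update_append)
        with mid show ?thesis
          by (intro exI[of _ "i - 1"] exI[of _ "\<lambda>a. as ! (i - 1) * a"]) (auto intro: lin_id M.lin_mult_right)
      next
        case 4
        then obtain l where "j = Suc (Suc (i - 1 + l))" using mid
          by (metis Suc_diff_1 add_Suc less_iff_Suc_add)
        then have "merge (i - 1) (as[j := a]) = (merge (i - 1) as)[j - 1 := a]" for a
          using as mid j by (simp add: merge_def drop_update_swap list_update_append)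
        moreover have "j - 1 < n" using mid 4 j by linarith
        ultimately show ?thesis
          by (intro exI[of _ "j - 1"] exI[of _ "\<lambda>a. a"] conjI allI lin_id)
      qed
    qed
    then obtain k g where "k < n" "lin sA sA g" "\<And>a. merge (i - 1) (as[j := a]) = (merge (i - 1) as)[k := g a]"
      by blast
    with mid lin_C_update[OF f len] show ?thesis by (simp add: b_body_def)
  next
    case 4
    then have "b_body n p i f m (as[j := a]) = f (tens sM sA (actM (as ! n) m) ((take n as)[j := a]))" for a
      by (simp add: b_body_def take_update_swap)
    with 4 as show ?thesis by (auto intro!: lin_C_update[OF f] lin_id)
  next
    case 5
    with as have "b_body n p i f m (as[j := a]) = f (tens sM sA (actM a m) (take n as))" for a
      by (simp add: b_body_def)
    with as show ?thesis by (auto intro!: lin_C_left[OF f] lin_id M.lin_act_left)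
  qed
qed

lemma b_body_in: "f \<in> C n p \<Longrightarrow> b_body n p i f m as \<in> T_N p"
  using C_in[of f n p] by (simp add: b_body_def act_T_in)

lemma cmap_b: "cmap n p (Suc n) p (b n p i)"
  unfolding b_eq_tlift[abs_def]
proof (rule cmap_tlift[OF multilinear_b_body b_body_in])
  fix f h m and as :: "'a list"
  assume f: "f \<in> C n p" and h: "h \<in> C n p"
  show "b_body n p i (f + h) m as = b_body n p i f m as + b_body n p i h m as"
    using tlin_act_T[of p] C_in[OF f] C_in[OF h] by (auto simp: b_body_def tlin_def)
qed

lemma b_tens: "f \<in> C n p \<Longrightarrow> length as = Suc n \<Longrightarrow> b n p i f (tens sM sA m as) = b_body n p i f m as"
  unfolding b_eq_tlift by (rule C_tlift(2)[OF multilinear_b_body b_body_in])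

lemma cmap_d_m: "cmap n p (Suc n) p (d_m n p)"
  unfolding d_m_def[abs_def] by (intro cmap_alt_sum cmap_b)

section \<open>Evaluation of the diagonal action; diagonal coaction against products, action and
  comultiplication\<close>

lemma act_T_tens:
  assumes "length ys = p"
  shows "act_T p a (tens sN sA y ys) =
    sweedler sA sA p (iter_comult p a) (\<lambda>x xs. tens sN sA (actN x y) (map2 (*) xs ys))"
  unfolding act_T_def
  by (rule sweedler_cong[OF M.vsA M.vsA iter_comult_in])
    (rule sweedler_tens[OF N.vsM M.vsA vector_space_tscale multilinear_act_tens assms])

text \<open>Separates the leg of \<open>a\<close> acting on N from the legs multiplying the factors
  from A. The map \<open>retract\<close> absorbs N and the first such factor into one, and this is
  the form in which that can be computed.\<close>

lemma act_T_Suc: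
  assumes "t \<in> T_N (Suc p)"
  shows "act_T (Suc p) a t = sweedler2 sA sA (\<Delta> a) (\<lambda>a1 a2. sweedler sA sA p (iter_comult p a2)
    (\<lambda>x xs. sweedler sN sA (Suc p) t (\<lambda>y ys. tens sN sA (actN a1 y) (map2 (*) (x # xs) ys))))"
proof -
  note ml = multilinear_act_T[OF assms]
  have in1: "sweedler sA sA p (iter_comult p a2) (\<lambda>x xs. tens sA sA a1 (x # xs)) \<in> tensor_space sA sA (Suc p)"
    for a1 a2 by (intro sweedler_in[OF M.vsA M.vsA iter_comult_in] tens_in_tensor_space) simp
  have eval: "sweedler sA sA (Suc p) (tens sA sA a1 (x # xs))
      (\<lambda>x xs. sweedler sN sA (Suc p) t (\<lambda>y ys. tens sN sA (actN x y) (map2 (*) xs ys))) =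
      sweedler sN sA (Suc p) t (\<lambda>y ys. tens sN sA (actN a1 y) (map2 (*) (x # xs) ys))"
    if "length xs = p" for a1 x xs
    by (rule sweedler_tens[OF M.vsA M.vsA vector_space_tscale ml]) (simp add: that)
  have *: "act_T (Suc p) a t = sweedler2 sA sA (\<Delta> a) (\<lambda>a1 a2. sweedler sA sA (Suc p)
      (sweedler sA sA p (iter_comult p a2) (\<lambda>x xs. tens sA sA a1 (x # xs)))
      (\<lambda>x xs. sweedler sN sA (Suc p) t (\<lambda>y ys. tens sN sA (actN x y) (map2 (*) xs ys))))"
    unfolding act_T_def iter_comult.simps
    by (rule sweedler2_sweedler[OF M.vsA M.vsA vector_space_tscale ml M.vsA M.vsA M.comult_in in1])
  have **: "sweedler sA sA (Suc p)
      (sweedler sA sA p (iter_comult p a2) (\<lambda>x xs. tens sA sA a1 (x # xs)))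
      (\<lambda>x xs. sweedler sN sA (Suc p) t (\<lambda>y ys. tens sN sA (actN x y) (map2 (*) xs ys))) =
      sweedler sA sA p (iter_comult p a2)
        (\<lambda>x xs. sweedler sN sA (Suc p) t (\<lambda>y ys. tens sN sA (actN a1 y) (map2 (*) (x # xs) ys)))"
    (is "sweedler sA sA (Suc p) _ ?g = _") for a1 a2
  proof -
    have "sweedler sA sA (Suc p) (sweedler sA sA p (iter_comult p a2) (\<lambda>x xs. tens sA sA a1 (x # xs))) ?g =
        sweedler sA sA p (iter_comult p a2) (\<lambda>x xs. sweedler sA sA (Suc p) (tens sA sA a1 (x # xs)) ?g)"
      by (rule sweedler_sweedler[OF M.vsA M.vsA vector_space_tscale ml M.vsA M.vsA iter_comult_in])
        (simp add: tens_in_tensor_space)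
    also have "\<dots> = sweedler sA sA p (iter_comult p a2)
        (\<lambda>x xs. sweedler sN sA (Suc p) t (\<lambda>y ys. tens sN sA (actN a1 y) (map2 (*) (x # xs) ys)))"
      by (rule sweedler_cong[OF M.vsA M.vsA iter_comult_in eval])
    finally show ?thesis .
  qed
  show ?thesis
    by (simp only: * **)
qed

lemma act_T_0: "act_T 0 a (tens sN sA y []) = tens sN sA (actN a y) []"
proof -
  have "sweedler sA sA 0 (tens sA sA a []) (\<lambda>x xs. tens sN sA (actN x y) (map2 (*) xs [])) = tens sN sA (actN a y) []"
    by (subst sweedler_tens[OF M.vsA M.vsA vector_space_tscale])
      (auto simp: multilinear_iff_lin[OF M.vsA M.vsA vector_space_tscale]
        intro!: lin_tens N.vsM M.vsA N.lin_act_left lin_id)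
  then show ?thesis by (simp add: act_T_tens)
qed

text \<open>Multiplicativity of \<Delta>: the first legs of a product are merged in the list, and
  the second legs occur next to each other in the total product anyway.\<close>

lemma diag_sum_merge:
  "Suc i < length as \<Longrightarrow> diag_multilinear (length as - 1) h \<Longrightarrow>
    diag_sum (merge i as) m h = diag_sum as m (\<lambda>xs. h (merge i xs))"
proof (induction i arbitrary: as h)
  case 0
  then obtain u w as' where as: "as = u # w # as'"
    by (cases as; cases "tl as") auto
  have h: "diag_multilinear (Suc (length as')) h" using 0 as by simp
  have "diag_sum (u * w # as') m h = sweedler2 sA sA (\<Delta> u) (\<lambda>u1 u2. sweedler2 sA sA (\<Delta> w) (\<lambda>w1 w2.
      diag_sum as' m (\<lambda>xs m0 z. h (u1 * w1 # xs) m0 (u2 * w2 * z))))"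
    unfolding diag_sum.simps
    by (rule M.sweedler2_comult_mult[OF vector_space_tscale])
      (auto intro!: lin_diag_sum_fun diag_multilinear_Cons[OF h] lin_comp[OF diag_multilinear_z[OF h] M.lin_mult_left[OF lin_id]])
  then show ?case by (simp add: as merge_def mult.assoc)
next
  case (Suc i)
  then obtain u as' where as: "as = u # as'" by (cases as) auto
  have "length as' - 1 = length as' - Suc 0" "Suc (length as' - 1) = length as'" using Suc.prems as by auto
  with Suc.prems as have h: "diag_multilinear (Suc (length as' - 1)) h" by simp
  have "diag_sum (u # merge i as') m h = diag_sum (u # as') m (\<lambda>xs. h (merge (Suc i) xs))"
    using Suc.IH[OF _ diag_multilinear_shift[OF h]] Suc.prems(1) by (simp add: as merge_def)
  then show ?case by (simp add: as merge_def)
qed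

text \<open>The Hopf condition on M says that coacting on a \<cdot> m is the same as coacting
  diagonally on a \<otimes> m and then acting.\<close>

lemma diag_sum_act:
  "diag_multilinear (length as) h \<Longrightarrow> diag_sum as (actM a m) h =
    diag_sum (as @ [a]) m (\<lambda>xs m0 z. h (take (length as) xs) (actM (xs ! length as) m0) z)"
proof (induction as arbitrary: h)
  case Nil
  show ?case
    unfolding diag_sum.simps append_Nil
    by (subst M.sweedler2_hopf_compat[OF vector_space_tscale])
      (use Nil in \<open>auto intro: diag_multilinear_m diag_multilinear_z\<close>)
next
  case (Cons u as)
  then have "diag_multilinear (Suc (length as)) h" by simp
  from Cons.IH[OF diag_multilinear_shift[OF this]] show ?case by simp
qed

text \<open>The diagonal coaction makes A^n \<otimes> M a comodule, and this is its coassociativity,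
  by induction on n. For n = 0 it is the comodule axiom of M.\<close>

lemma diag_sum_coassoc:
  assumes "\<And>z'. diag_multilinear (length as) (\<lambda>xs m z. h xs m z z')"
    and "\<And>xs m z. length xs = length as \<Longrightarrow> lin sA tscale (\<lambda>z'. h xs m z z')"
  shows "diag_sum as m (\<lambda>xs m0 z'. diag_sum xs m0 (\<lambda>xs' m' z. h xs' m' z z')) =
    diag_sum as m (\<lambda>xs m0 z. sweedler2 sA sA (\<Delta> z) (\<lambda>u v. h xs m0 u v))"
  using assms
proof (induction as arbitrary: h)
  case Nil
  have "lin sM tscale (\<lambda>m. h [] m z z')" "lin sA tscale (\<lambda>z. h [] m z z')"
    "lin sA tscale (\<lambda>z'. h [] m z z')" for m z z'
    using diag_multilinear_m[OF Nil(1), of "[]"] diag_multilinear_z[OF Nil(1), of "[]"] Nil(2)[of "[]"] by simp_all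
  then show ?case unfolding diag_sum.simps
    by (intro M.sweedler2_coact_coassoc[OF vector_space_tscale])
next
  case (Cons a as)
  have h1: "diag_multilinear (Suc (length as)) (\<lambda>xs m z. h xs m z z')" for z' using Cons.prems(1) by simp
  have h2: "lin sA tscale (\<lambda>z'. h (x # xs) m z z')" if "length xs = length as" for x xs m z
    using Cons.prems(2) that by simp
  have IH: "diag_sum as m (\<lambda>xs m0 z'. diag_sum xs m0 (\<lambda>xs' m' z. h (x # xs') m' (y * z) (w * z'))) =
      diag_sum as m (\<lambda>xs m0 z. sweedler2 sA sA (\<Delta> z) (\<lambda>u v. h (x # xs) m0 (y * u) (w * v)))" for x y w
    by (rule Cons.IH) (auto intro: diag_multilinear_shift[OF h1] lin_comp[OF h2 M.lin_mult_right[OF lin_id]])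
  have "diag_sum (a # as) m (\<lambda>xs m0 z'. diag_sum xs m0 (\<lambda>xs' m' z. h xs' m' z z')) =
      sweedler2 sA sA (\<Delta> a) (\<lambda>a1 a2. diag_sum as m (\<lambda>xs m0 z'. sweedler2 sA sA (\<Delta> a1) (\<lambda>x y.
        diag_sum xs m0 (\<lambda>xs' m' z. h (x # xs') m' (y * z) (a2 * z')))))"
    by simp
  also have "\<dots> = sweedler2 sA sA (\<Delta> a) (\<lambda>a1 a2. sweedler2 sA sA (\<Delta> a1) (\<lambda>x y.
      diag_sum as m (\<lambda>xs m0 z. sweedler2 sA sA (\<Delta> z) (\<lambda>u v. h (x # xs) m0 (y * u) (a2 * v)))))"
    by (simp add: IH flip: sweedler2_diag_sum_swap)
  also have "\<dots> = sweedler2 sA sA (\<Delta> a) (\<lambda>a1 a2. sweedler2 sA sA (\<Delta> a2) (\<lambda>y w.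
      diag_sum as m (\<lambda>xs m0 z. sweedler2 sA sA (\<Delta> z) (\<lambda>u v. h (a1 # xs) m0 (y * u) (w * v)))))"
    by (rule M.sweedler2_coassoc[OF vector_space_tscale])
      (intro lin_diag_sum_fun lin_sweedler2_fun vector_space_tscale,
       auto intro: diag_multilinear_Cons[OF h1] lin_comp[OF diag_multilinear_z[OF h1] M.lin_mult_left[OF lin_id]]
        lin_comp[OF h2 M.lin_mult_left[OF lin_id]])+
  \<comment> \<open>The second legs of the head and of the tail are comultiplied separately;
    multiplicativity of \<Delta> combines them into \<Delta>(a_2 z).\<close>
  also have "\<dots> = sweedler2 sA sA (\<Delta> a) (\<lambda>a1 a2. diag_sum as m (\<lambda>xs m0 z.
      sweedler2 sA sA (\<Delta> (a2 * z)) (\<lambda>u v. h (a1 # xs) m0 u v)))"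
    unfolding sweedler2_diag_sum_swap
    by (intro arg_cong[where f = "sweedler2 sA sA (\<Delta> a)"] ext diag_sum_cong
        M.sweedler2_comult_mult[OF vector_space_tscale, symmetric])
      (auto intro: diag_multilinear_z[OF h1] h2)
  finally show ?case by simp
qed

section \<open>Additivity of the total complex\<close>

lemma tot_C: "F \<in> tot r \<Longrightarrow> F n \<in> C n (r - n)"
  using zero_in_C by (cases "n \<le> r") (auto simp: tot_def)

lemma tot_add: "F \<in> tot r \<Longrightarrow> G \<in> tot r \<Longrightarrow> F + G \<in> tot r"
  by (auto simp: tot_def intro: add_in_C)

lemma tot_uminus: "F \<in> tot r \<Longrightarrow> - F \<in> tot r"
  by (auto simp: tot_def intro: uminus_in_C)

lemma tot_0: "0 \<in> tot r"
  by (auto simp: tot_def zero_in_C)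

lemma tot_d_add:
  assumes F: "F \<in> tot r" and G: "G \<in> tot r"
  shows "tot_d r (F + G) = tot_d r F + tot_d r G"
proof
  fix n
  have rows: "(if 1 \<le> n \<and> n \<le> r + 1 then d_m (n - 1) (r + 1 - n) ((F + G) (n - 1)) else 0) =
      (if 1 \<le> n \<and> n \<le> r + 1 then d_m (n - 1) (r + 1 - n) (F (n - 1)) else 0) +
      (if 1 \<le> n \<and> n \<le> r + 1 then d_m (n - 1) (r + 1 - n) (G (n - 1)) else 0)" (is "?l = ?f + ?g")
  proof (cases "1 \<le> n \<and> n \<le> r + 1")
    case True
    then have "r + 1 - n = r - (n - 1)" by simp
    then have "d_m (n - 1) (r + 1 - n) ((F + G) (n - 1)) =
        d_m (n - 1) (r + 1 - n) (F (n - 1)) + d_m (n - 1) (r + 1 - n) (G (n - 1))"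
      using cmap_add[OF cmap_d_m tot_C[OF F] tot_C[OF G], of "n - 1"]
      by (simp only: plus_fun_apply[of F G "n - 1"])
    with True show ?thesis by (simp only: if_True simp_thms)
  qed (simp only: if_False add_0_left)
  have cols: "(if n \<le> r then alt n (d_c n (r - n) ((F + G) n)) else 0) =
      (if n \<le> r then alt n (d_c n (r - n) (F n)) else 0) + (if n \<le> r then alt n (d_c n (r - n) (G n)) else 0)"
  proof (cases "n \<le> r")
    case True
    then show ?thesis
      using cmap_add[OF cmap_d_c tot_C[OF F] tot_C[OF G], of n]
      by (simp only: plus_fun_apply[of F G n] alt_plus if_True)
  qed (simp only: if_False add_0_left)
  have "(tot_d r F + tot_d r G) n = tot_d r F n + tot_d r G n" by (rule plus_fun_apply)
  then show "tot_d r (F + G) n = (tot_d r F + tot_d r G) n"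
    unfolding tot_d_def rows cols by (simp only: ac_simps)
qed

lemma tot_d_0: "tot_d r 0 = 0"
  using tot_d_add[OF tot_0 tot_0, of r] by simp

lemma tot_d_uminus: "F \<in> tot r \<Longrightarrow> tot_d r (- F) = - tot_d r F"
  using tot_d_add[OF _ tot_uminus, of F r F] tot_d_0[of r] by (simp add: eq_neg_iff_add_eq_0 add.commute)

end

section \<open>Contracting homotopies\<close>

locale skew_hopf_complex = hopf_complex sA \<Delta> \<epsilon> sM actM \<rho>M sN actN \<rho>N
  for sA :: "'k::field \<Rightarrow> 'a::ring_1 \<Rightarrow> 'a" and \<Delta> \<epsilon>
    and sM :: "'k \<Rightarrow> 'm::ab_group_add \<Rightarrow> 'm" and actM \<rho>M
    and sN :: "'k \<Rightarrow> 'n::ab_group_add \<Rightarrow> 'n" and actN \<rho>N +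
  fixes S :: "'a \<Rightarrow> 'a"
  assumes skew: "skew_antipode sA \<Delta> \<epsilon> S"

sublocale skew_hopf_complex \<subseteq> M: skew_hopf_module sA \<Delta> \<epsilon> sM actM \<rho>M S
  by unfold_locales (rule skew)

sublocale skew_hopf_complex \<subseteq> N: skew_hopf_module sA \<Delta> \<epsilon> sN actN \<rho>N S
  by unfold_locales (rule skew)

context skew_hopf_complex
begin

section \<open>The column homotopy t, induced by n \<otimes> a \<mapsto> a \<cdot> P n on the first
  two factors\<close>

definition retract :: "nat \<Rightarrow> ('k, 'n, 'a) tensor \<Rightarrow> ('k, 'n, 'a) tensor" where
  "retract p t = sweedler sN sA (Suc p) t (\<lambda>y ys. tens sN sA (actN (hd ys) (N.P y)) (tl ys))"

lemma multilinear_retract: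
  "multilinear sN sA tscale (Suc p) (\<lambda>y ys. tens sN sA (actN (hd ys) (N.P y)) (tl ys))"
  unfolding multilinear_iff_lin[OF N.vsM M.vsA vector_space_tscale]
proof (intro conjI allI impI)
  fix y and ys :: "'a list" and i assume ys: "length ys = Suc p" and i: "i < Suc p"
  obtain y0 ys' where [simp]: "ys = y0 # ys'" using ys by (cases ys) auto
  show "lin sA tscale (\<lambda>a. tens sN sA (actN (hd (ys[i := a])) (N.P y)) (tl (ys[i := a])))"
  proof (cases i)
    case 0
    then show ?thesis by simp (intro lin_tens N.vsM M.vsA N.lin_act_left lin_id)
  next
    case (Suc j)
    with ys i show ?thesis by simp (intro lin_tens_update N.vsM M.vsA lin_id, simp)
  qed
qed (intro lin_tens N.vsM M.vsA N.lin_act_right N.lin_P lin_id)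

lemma tlin_retract: "tlin sN sA (Suc p) tscale (retract p)"
  unfolding retract_def by (rule tlin_sweedler[OF N.vsM M.vsA vector_space_tscale multilinear_retract])

lemma retract_in: "t \<in> T_N (Suc p) \<Longrightarrow> retract p t \<in> T_N p"
  unfolding retract_def by (rule N_in) (auto intro: tens_in_tensor_space)

lemma retract_tens:
  "length ys = p \<Longrightarrow> retract p (tens sN sA y (a # ys)) = tens sN sA (actN a (N.P y)) ys"
  unfolding retract_def
  by (subst sweedler_tens[OF N.vsM M.vsA vector_space_tscale multilinear_retract]) simp_all

lemma retract_sweedler2:
  assumes "vector_space sW" "vector_space sB" "t \<in> tensor_space sW sB 1"
    and "\<And>v a. h v a \<in> T_N (Suc p)"
  shows "retract p (sweedler2 sW sB t h) = sweedler2 sW sB t (\<lambda>v a. retract p (h v a))"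
  unfolding sweedler2_def
  by (rule sweedler_push[OF assms(1,2) tlin_additive_on[OF tlin_retract] assms(3)]) (rule assms(4))

lemma retract_coface_0:
  assumes "t \<in> T_N p"
  shows "retract p (coface p 0 t) = t"
proof (rule tlin_eqI[OF N.vsM M.vsA tlin_tlin[OF tlin_retract tlin_coface coface_in] _ assms, where L' = "\<lambda>t. t" and sU' = tscale])
  fix y and ys :: "'a list" assume ys: "length ys = p"
  have "retract p (coface p 0 (tens sN sA y ys)) =
      sweedler2 sN sA (\<rho>N y) (\<lambda>y0 y1. tens sN sA (actN y1 (N.P y0)) ys)"
    using ys by (simp add: coface_tens retract_sweedler2[OF N.vsM M.vsA N.coact_in]
        retract_tens tens_in_tensor_space)
  also have "\<dots> = tens sN sA y ys"
    by (simp add: N.P_decomp flip: sweedler2_push_lin[OF N.vsM M.vsA lin_tens[OF N.vsM M.vsA lin_id] N.coact_in])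
  finally show "retract p (coface p 0 (tens sN sA y ys)) = tens sN sA y ys" .
qed (simp_all add: tlin_def)

text \<open>For i = 0 this is colinearity of n \<otimes> a \<mapsto> a \<cdot> P n: as P n is
  coinvariant, the coaction of a \<cdot> P n is \<Sum> a_1 \<cdot> P n \<otimes> a_2. For i > 0 the
  comultiplied factor is one that \<open>retract\<close> leaves alone.\<close>

lemma retract_coface_Suc:
  assumes "i \<le> p" "t \<in> T_N (Suc p)"
  shows "retract (Suc p) (coface (Suc p) (Suc i) t) = coface p i (retract p t)"
proof (rule tlin_eqI[OF N.vsM M.vsA tlin_tlin[OF tlin_retract tlin_coface coface_in]
      tlin_tlin[OF tlin_coface tlin_retract retract_in] assms(2)])
  fix y and ys :: "'a list" assume "length ys = Suc p"
  then obtain y0 ys' where ys: "ys = y0 # ys'" "length ys' = p" by (cases ys) auto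
  show "retract (Suc p) (coface (Suc p) (Suc i) (tens sN sA y ys)) = coface p i (retract p (tens sN sA y ys))"
  proof (cases i)
    case 0
    have "coface p 0 (tens sN sA (actN y0 (N.P y)) ys') =
        sweedler2 sA sA (\<Delta> y0) (\<lambda>u w. sweedler2 sN sA (\<rho>N (N.P y)) (\<lambda>v0 v1.
          tens sN sA (actN u v0) (w * v1 # ys')))"
      using ys(2)
      by (simp add: coface_tens, intro N.sweedler2_hopf_compat[OF vector_space_tscale]
          lin_tens lin_tens_Cons N.vsM M.vsA lin_id)
    also have "\<dots> = sweedler2 sA sA (\<Delta> y0) (\<lambda>u w. tens sN sA (actN u (N.P y)) (w # ys'))"
      by (subst N.P_coinvariant[OF vector_space_tscale])
        (auto intro!: lin_tens lin_tens_Cons N.vsM M.vsA N.lin_act_right M.lin_mult_right lin_id)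
    finally show ?thesis using 0 ys
      by (simp add: coface_tens retract_sweedler2[OF M.vsA M.vsA M.comult_in] retract_tens tens_in_tensor_space)
  next
    case (Suc j)
    with assms(1) ys show ?thesis
      by (simp add: coface_tens retract_sweedler2[OF M.vsA M.vsA M.comult_in] retract_tens tens_in_tensor_space)
  qed
qed (use assms in simp_all)

lemma retract_append_T:
  assumes "t \<in> T_N (Suc p)"
  shows "retract (Suc p) (append_T (Suc p) z t) = append_T p z (retract p t)"
proof (rule tlin_eqI[OF N.vsM M.vsA tlin_tlin[OF tlin_retract tlin_append_T append_T_in]
      tlin_tlin[OF tlin_append_T tlin_retract retract_in] assms])
  fix y and ys :: "'a list" assume "length ys = Suc p"
  then show "retract (Suc p) (append_T (Suc p) z (tens sN sA y ys)) = append_T p z (retract p (tens sN sA y ys))"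
    by (cases ys) (simp_all add: append_T_tens retract_tens)
qed

text \<open>The leg a_1 acting on N meets P and becomes \<epsilon>(a_1), and the counit axiom then
  removes it from the iterated comultiplication. What is left is the action with one leg fewer, as
  required for one tensor factor fewer.\<close>

lemma retract_act_T:
  assumes "t \<in> T_N (Suc p)"
  shows "retract p (act_T (Suc p) a t) = act_T p a (retract p t)"
proof (rule tlin_eqI[OF N.vsM M.vsA tlin_tlin[OF tlin_retract tlin_act_T act_T_in]
      tlin_tlin[OF tlin_act_T tlin_retract retract_in] assms])
  fix y and ys :: "'a list" assume "length ys = Suc p"
  then obtain y0 ys' where ys: "ys = y0 # ys'" "length ys' = p" by (cases ys) auto
  note rin = tens_in_tensor_space sweedler_in[OF M.vsA M.vsA iter_comult_in]
  have *: "act_T (Suc p) a (tens sN sA y ys) = sweedler2 sA sA (\<Delta> a) (\<lambda>a1 a2.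
      sweedler sA sA p (iter_comult p a2) (\<lambda>x xs. tens sN sA (actN a1 y) (x * y0 # map2 (*) xs ys')))"
  proof -
    have "sweedler sN sA (Suc p) (tens sN sA y ys) (\<lambda>y ys. tens sN sA (actN a1 y) (map2 (*) (x # xs) ys)) =
        tens sN sA (actN a1 y) (x * y0 # map2 (*) xs ys')" if "length xs = p" for a1 x xs
      by (subst sweedler_tens[OF N.vsM M.vsA vector_space_tscale multilinear_act_tens])
        (simp_all add: ys that)
    then have "sweedler sA sA p (iter_comult p a2) (\<lambda>x xs. sweedler sN sA (Suc p) (tens sN sA y ys)
          (\<lambda>y ys. tens sN sA (actN a1 y) (map2 (*) (x # xs) ys))) =
        sweedler sA sA p (iter_comult p a2) (\<lambda>x xs. tens sN sA (actN a1 y) (x * y0 # map2 (*) xs ys'))"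
      for a1 a2 by (rule sweedler_cong[OF M.vsA M.vsA iter_comult_in])
    then show ?thesis
      by (simp only: act_T_Suc[OF tens_in_tensor_space[OF \<open>length ys = Suc p\<close>]])
  qed
  have "retract p (act_T (Suc p) a (tens sN sA y ys)) = sweedler2 sA sA (\<Delta> a) (\<lambda>a1 a2.
      sweedler sA sA p (iter_comult p a2) (\<lambda>x xs. tens sN sA (actN (x * y0) (N.P (actN a1 y))) (map2 (*) xs ys')))"
    unfolding *
  proof (subst retract_sweedler2[OF M.vsA M.vsA M.comult_in])
    show "sweedler sA sA p (iter_comult p a2) (\<lambda>x xs. tens sN sA (actN a1 y) (x * y0 # map2 (*) xs ys')) \<in> T_N (Suc p)"
      for a1 a2 using ys by (intro rin) simp
    have "retract p (sweedler sA sA p (iter_comult p a2) (\<lambda>x xs. tens sN sA (actN a1 y) (x * y0 # map2 (*) xs ys'))) =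
      sweedler sA sA p (iter_comult p a2) (\<lambda>x xs. tens sN sA (actN (x * y0) (N.P (actN a1 y))) (map2 (*) xs ys'))"
      for a1 a2
    proof -
      have "retract p (sweedler sA sA p (iter_comult p a2) (\<lambda>x xs. tens sN sA (actN a1 y) (x * y0 # map2 (*) xs ys'))) =
        sweedler sA sA p (iter_comult p a2) (\<lambda>x xs. retract p (tens sN sA (actN a1 y) (x * y0 # map2 (*) xs ys')))"
        by (rule sweedler_push[OF M.vsA M.vsA tlin_additive_on[OF tlin_retract] iter_comult_in])
          (simp add: tens_in_tensor_space ys)
      also have "\<dots> = sweedler sA sA p (iter_comult p a2) (\<lambda>x xs. tens sN sA (actN (x * y0) (N.P (actN a1 y))) (map2 (*) xs ys'))"
        by (rule sweedler_cong[OF M.vsA M.vsA iter_comult_in]) (simp add: retract_tens ys)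
      finally show ?thesis .
    qed
    then show "sweedler2 sA sA (\<Delta> a) (\<lambda>a1 a2. retract p (sweedler sA sA p (iter_comult p a2)
        (\<lambda>x xs. tens sN sA (actN a1 y) (x * y0 # map2 (*) xs ys')))) =
      sweedler2 sA sA (\<Delta> a) (\<lambda>a1 a2. sweedler sA sA p (iter_comult p a2)
        (\<lambda>x xs. tens sN sA (actN (x * y0) (N.P (actN a1 y))) (map2 (*) xs ys')))"
      by simp
  qed
  also have "\<dots> = sweedler2 sA sA (\<Delta> a) (\<lambda>a1 a2. tscale (\<epsilon> a1) (act_T p a2 (tens sN sA (actN y0 (N.P y)) ys')))"
  proof -
    have "sweedler sA sA p (iter_comult p a2) (\<lambda>x xs. tens sN sA (actN (x * y0) (N.P (actN a1 y))) (map2 (*) xs ys')) =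
        tscale (\<epsilon> a1) (act_T p a2 (tens sN sA (actN y0 (N.P y)) ys'))" for a1 a2
    proof -
      have *: "lin tscale tscale (tscale k :: ('k, 'n, 'a) tensor \<Rightarrow> _)" for k
        by (simp add: lin_def tscale_def fun_eq_iff algebra_simps)
      have **: "tens sN sA (actN x (actN y0 (sN k v))) zs = tscale k (tens sN sA (actN x (actN y0 v)) zs)" for k x v zs
        using lin_tens[OF N.vsM M.vsA N.lin_act_right[OF N.lin_act_right[OF lin_id]], of x y0 zs]
        by (simp add: lin_def)
      show ?thesis
        by (simp add: act_T_tens ys sweedler_push_lin[OF M.vsA M.vsA * iter_comult_in] N.P_act N.act_mult **)
    qed
    then show ?thesis by simp
  qed
  also have "\<dots> = act_T p a (tens sN sA (actN y0 (N.P y)) ys')"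
    by (rule M.sweedler2_counit_left[OF vector_space_tscale])
      (use lin_act_T[OF tens_in_tensor_space lin_id] ys in simp)
  finally show "retract p (act_T (Suc p) a (tens sN sA y ys)) = act_T p a (retract p (tens sN sA y ys))"
    by (simp add: ys retract_tens)
qed

definition col_htp :: "nat \<Rightarrow> (('k, 'm, 'a) tensor \<Rightarrow> ('k, 'n, 'a) tensor) \<Rightarrow> ('k, 'm, 'a) tensor \<Rightarrow> ('k, 'n, 'a) tensor"
  where "col_htp p f = (\<lambda>x. retract p (f x))"

lemma cmap_col_htp: "cmap n (Suc p) n p (col_htp p)"
  unfolding col_htp_def[abs_def] by (rule cmap_pointwise[OF tlin_retract retract_in])

lemma col_htp_c_0: "f \<in> C n p \<Longrightarrow> col_htp p (c n p 0 f) = f"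
  by (simp add: col_htp_def c_eq_coface retract_coface_0 C_in[of f n p])

text \<open>Together with \<open>col_htp_c_0\<close> these are the identities of an extra degeneracy
  at the front of the cosimplicial direction. The last face needs its own argument because it alters
  the arguments of f too; it appends at the far end of the tensor, away from the factors that
  \<open>retract\<close> touches.\<close>

lemma col_htp_c_Suc:
  assumes f: "f \<in> C n (Suc p)" and i: "i \<le> Suc p"
  shows "col_htp (Suc p) (c n (Suc p) (Suc i) f) = c n p i (col_htp p f)"
proof (cases "i = Suc p")
  case False
  with i have "i \<le> p" by simp
  then show ?thesis
    by (simp add: col_htp_def c_eq_coface retract_coface_Suc C_in[OF f])
next
  case True
  note t = cmap_in[OF cmap_col_htp f]
  have "col_htp (Suc p) (c n (Suc p) (Suc (Suc p)) f) = c n p (Suc p) (col_htp p f)"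
  proof (rule C_eqI[OF cmap_in[OF cmap_col_htp cmap_in[OF cmap_c_last f]] cmap_in[OF cmap_c_last t]])
    fix m and as :: "'a list" assume as: "length as = n"
    show "col_htp (Suc p) (c n (Suc p) (Suc (Suc p)) f) (tens sM sA m as) =
        c n p (Suc p) (col_htp p f) (tens sM sA m as)"
      unfolding c_last_tens[OF t as]
      by (simp add: col_htp_def c_last_tens[OF f as] diag_sum_push[OF tlin_retract] append_T_in
          retract_append_T C_in[OF f])
  qed
  with True show ?thesis by simp
qed

lemma col_htp_b:
  assumes f: "f \<in> C n (Suc p)"
  shows "col_htp p (b n (Suc p) i f) = b n p i (col_htp p f)"
proof -
  note t = cmap_in[OF cmap_col_htp f]
  show ?thesis
  proof (rule C_eqI[OF cmap_in[OF cmap_col_htp cmap_in[OF cmap_b f]] cmap_in[OF cmap_b t]])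
    fix m and as :: "'a list" assume as: "length as = Suc n"
    show "col_htp p (b n (Suc p) i f) (tens sM sA m as) = b n p i (col_htp p f) (tens sM sA m as)"
      unfolding b_tens[OF t as]
      by (simp add: col_htp_def b_tens[OF f as] b_body_def retract_act_T C_in[OF f])
  qed
qed

lemma cmap_push_alt_sum:
  assumes "cmap n p n' p' L" "\<And>i. i \<in> I \<Longrightarrow> f i \<in> C n p"
  shows "L (\<Sum>i\<in>I. alt i (f i)) = (\<Sum>i\<in>I. alt i (L (f i)))"
  using cmap_sum[OF assms(1) alt_in_C[OF assms(2)], of I] cmap_alt[OF assms(1) assms(2)]
  by (simp cong: sum.cong)

lemma col_htp_d_m:
  assumes f: "f \<in> C n (Suc p)"
  shows "col_htp p (d_m n (Suc p) f) = d_m n p (col_htp p f)"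
  unfolding d_m_def
  by (subst cmap_push_alt_sum[OF cmap_col_htp cmap_in[OF cmap_b f]]) (simp only: col_htp_b[OF f])

lemma cmap_c_all: "i \<le> Suc p \<Longrightarrow> cmap n p n (Suc p) (c n p i)"
  using cmap_c[of i p n] cmap_c_last[of n p] le_Suc_eq by metis

text \<open>The face with index 0 returns f. Each other face loses one from its index, which flips
  its sign and gives the negative of the lower differential.\<close>

lemma col_htp_d_c:
  assumes f: "f \<in> C n (Suc p)"
  shows "col_htp (Suc p) (d_c n (Suc p) f) = f - d_c n p (col_htp p f)"
proof -
  have "col_htp (Suc p) (d_c n (Suc p) f) =
      (\<Sum>i = 0..Suc (Suc p). alt i (col_htp (Suc p) (c n (Suc p) i f)))"
    unfolding d_c_def Suc_eq_plus1[symmetric]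
    by (rule cmap_push_alt_sum[OF cmap_col_htp cmap_in[OF cmap_c_all f]]) simp
  also have "\<dots> = alt 0 (col_htp (Suc p) (c n (Suc p) 0 f)) +
      (\<Sum>i = 0..Suc p. alt (Suc i) (col_htp (Suc p) (c n (Suc p) (Suc i) f)))"
    by (subst sum.atLeast0_atMost_Suc_shift) (simp only: o_def)
  also have "\<dots> = f + (\<Sum>i = 0..Suc p. - alt i (c n p i (col_htp p f)))"
    by (intro arg_cong2[where f = plus] sum.cong)
      (simp_all add: col_htp_c_0[OF f] col_htp_c_Suc[OF f] alt_def[of 0] alt_Suc)
  finally show ?thesis
    by (simp only: d_c_def Suc_eq_plus1[symmetric] sum_negf add_uminus_conv_diff)
qed

section \<open>The row homotopy s, precomposition with m \<mapsto> \<Sum> m_1 \<otimes> P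
  m_0\<close>

definition row_htp :: "nat \<Rightarrow> (('k, 'm, 'a) tensor \<Rightarrow> ('k, 'n, 'a) tensor) \<Rightarrow> ('k, 'm, 'a) tensor \<Rightarrow> ('k, 'n, 'a) tensor"
  where "row_htp n f = tlift sM sA n (\<lambda>m as. sweedler2 sM sA (\<rho>M m) (\<lambda>m0 m1.
    f (tens sM sA (M.P m0) (as @ [m1]))))"

lemma multilinear_row_htp:
  assumes f: "f \<in> C (Suc n) p"
  shows "multilinear sM sA tscale n (\<lambda>m as. sweedler2 sM sA (\<rho>M m) (\<lambda>m0 m1.
    f (tens sM sA (M.P m0) (as @ [m1]))))"
  unfolding multilinear_iff_lin[OF M.vsM M.vsA vector_space_tscale]
proof (intro conjI allI impI)
  fix as :: "'a list" assume as: "length as = n"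
  show "lin sM tscale (\<lambda>m. sweedler2 sM sA (\<rho>M m) (\<lambda>m0 m1. f (tens sM sA (M.P m0) (as @ [m1]))))"
    by (rule M.lin_sweedler2_coact[OF vector_space_tscale _ _ lin_id])
      (use as in \<open>auto intro!: lin_C_left[OF f] lin_C_snoc[OF f] M.lin_P lin_id\<close>)
  fix m i assume i: "i < n"
  have "lin sA tscale (\<lambda>a. f (tens sM sA (M.P m0) (as[i := a] @ [m1])))" for m0 m1
    using lin_C_update[OF f _ _ lin_id, of "as @ [m1]" i "M.P m0"] as i by (simp add: list_update_append)
  then show "lin sA tscale (\<lambda>a. sweedler2 sM sA (\<rho>M m) (\<lambda>m0 m1. f (tens sM sA (M.P m0) (as[i := a] @ [m1]))))"
    by (rule lin_sweedler2_fun[OF vector_space_tscale])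
qed

lemma row_htp_in:
  "f \<in> C (Suc n) p \<Longrightarrow> sweedler2 sM sA (\<rho>M m) (\<lambda>m0 m1. f (tens sM sA (M.P m0) (as @ [m1]))) \<in> T_N p"
  by (rule sweedler2_in[OF M.vsM M.vsA M.coact_in]) (erule C_in)

lemma cmap_row_htp: "cmap (Suc n) p n p (row_htp n)"
  unfolding row_htp_def[abs_def]
proof (rule cmap_tlift[OF multilinear_row_htp row_htp_in])
  fix f h :: "('k, 'm, 'a) tensor \<Rightarrow> ('k, 'n, 'a) tensor" and m and as :: "'a list"
  have *: "(\<lambda>m0 as'. (f + h) (tens sM sA (M.P m0) (as @ [as' ! 0]))) =
      (\<lambda>m0 as'. f (tens sM sA (M.P m0) (as @ [as' ! 0])) + h (tens sM sA (M.P m0) (as @ [as' ! 0])))"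
    by (intro ext) simp
  show "sweedler2 sM sA (\<rho>M m) (\<lambda>m0 m1. (f + h) (tens sM sA (M.P m0) (as @ [m1]))) =
      sweedler2 sM sA (\<rho>M m) (\<lambda>m0 m1. f (tens sM sA (M.P m0) (as @ [m1]))) +
      sweedler2 sM sA (\<rho>M m) (\<lambda>m0 m1. h (tens sM sA (M.P m0) (as @ [m1])))"
    unfolding sweedler2_def * by (rule sweedler_add_fun)
qed

lemma row_htp_tens: "f \<in> C (Suc n) p \<Longrightarrow> length as = n \<Longrightarrow>
    row_htp n f (tens sM sA m as) = sweedler2 sM sA (\<rho>M m) (\<lambda>m0 m1. f (tens sM sA (M.P m0) (as @ [m1])))"
  unfolding row_htp_def by (rule C_tlift(2)[OF multilinear_row_htp row_htp_in])

text \<open>The only face meeting the new factor is i = n + 1. It multiplies m_1 by a^{n+1} on one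
  side and replaces m by a^{n+1} \<cdot> m on the other; they agree because \<Sum> a_2 m_1 \<otimes>
  P(a_1 \<cdot> m_0) = \<Sum> a m_1 \<otimes> P m_0, which is A-linearity of the splitting.\<close>

lemma row_htp_b:
  assumes f: "f \<in> C (Suc n) p" and i: "i \<le> Suc n"
  shows "row_htp (Suc n) (b (Suc n) p i f) = b n p i (row_htp n f)"
proof -
  note s = cmap_in[OF cmap_row_htp f]
  show ?thesis
  proof (rule C_eqI[OF cmap_in[OF cmap_row_htp cmap_in[OF cmap_b f]] cmap_in[OF cmap_b s]])
    fix m and as :: "'a list" assume as: "length as = Suc n"
    have lhs: "row_htp (Suc n) (b (Suc n) p i f) (tens sM sA m as) =
        sweedler2 sM sA (\<rho>M m) (\<lambda>m0 m1. b_body (Suc n) p i f (M.P m0) (as @ [m1]))"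
      using as by (simp add: row_htp_tens[OF cmap_in[OF cmap_b f]] b_tens[OF f])
    consider "i = 0" | "0 < i" "i \<le> n" | "i = Suc n" using i by linarith
    then have "sweedler2 sM sA (\<rho>M m) (\<lambda>m0 m1. b_body (Suc n) p i f (M.P m0) (as @ [m1])) =
        b_body n p i (row_htp n f) m as"
    proof cases
      case 1
      obtain a as' where [simp]: "as = a # as'" using as by (cases as) auto
      have "act_T p a (sweedler2 sM sA (\<rho>M m) (\<lambda>m0 m1. f (tens sM sA (M.P m0) (as' @ [m1])))) =
          sweedler2 sM sA (\<rho>M m) (\<lambda>m0 m1. act_T p a (f (tens sM sA (M.P m0) (as' @ [m1]))))"
        unfolding sweedler2_def
        by (rule sweedler_push[OF M.vsM M.vsA tlin_additive_on[OF tlin_act_T] M.coact_in]) (rule C_in[OF f])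
      with 1 as show ?thesis by (simp add: b_body_def row_htp_tens[OF f])
    next
      case 2
      then have "merge (i - 1) (as @ [z]) = merge (i - 1) as @ [z]" for z
        using as by (cases i) (simp_all add: merge_def nth_append)
      moreover have "length (merge (i - 1) as) = n" using 2 as by (simp add: merge_def)
      ultimately show ?thesis using 2 by (simp add: b_body_def row_htp_tens[OF f])
    next
      case 3
      have lin: "lin sM tscale (\<lambda>m0. f (tens sM sA (M.P m0) (take n as @ [m1])))"
        "lin sA tscale (\<lambda>m1. f (tens sM sA (M.P m0) (take n as @ [m1])))" for m0 m1
        using as by (auto intro!: lin_C_left[OF f] lin_C_snoc[OF f] M.lin_P lin_id)
      have "b_body n p i (row_htp n f) m as =
          sweedler2 sM sA (\<rho>M (actM (as ! n) m)) (\<lambda>m0 m1. f (tens sM sA (M.P m0) (take n as @ [m1])))"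
        using 3 as by (simp add: b_body_def row_htp_tens[OF f])
      also have "\<dots> = sweedler2 sA sA (\<Delta> (as ! n)) (\<lambda>a1 a2. sweedler2 sM sA (\<rho>M m) (\<lambda>m0 m1.
          f (tens sM sA (M.P (actM a1 m0)) (take n as @ [a2 * m1]))))"
        by (rule M.sweedler2_hopf_compat[OF vector_space_tscale lin])
      also have "\<dots> = sweedler2 sM sA (\<rho>M m) (\<lambda>m0 m1. sweedler2 sA sA (\<Delta> (as ! n)) (\<lambda>a1 a2.
          tscale (\<epsilon> a1) (f (tens sM sA (M.P m0) (take n as @ [a2 * m1])))))"
      proof -
        have "f (tens sM sA (sM k m0) (take n as @ [z])) = tscale k (f (tens sM sA m0 (take n as @ [z])))" for k m0 z
          using lin_C_left[OF f _ lin_id, of "take n as @ [z]"] as by (simp add: lin_def)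
        then show ?thesis by (subst sweedler2_swap) (simp add: M.P_act)
      qed
      also have "\<dots> = sweedler2 sM sA (\<rho>M m) (\<lambda>m0 m1. f (tens sM sA (M.P m0) (take n as @ [as ! n * m1])))"
        by (subst M.sweedler2_counit_left[OF vector_space_tscale])
          (auto intro: lin_comp[OF lin(2) M.lin_mult_left[OF lin_id]])
      finally show ?thesis using 3 as by (simp add: b_body_def merge_def nth_append)
    qed
    then show "row_htp (Suc n) (b (Suc n) p i f) (tens sM sA m as) = b n p i (row_htp n f) (tens sM sA m as)"
      by (simp only: lhs b_tens[OF s as])
  qed
qed

text \<open>The last face lets m_1 act on P m_0, and \<Sum> m_1 \<cdot> P m_0 = m.\<close>

lemma row_htp_b_last:
  assumes f: "f \<in> C (Suc n) p"
  shows "row_htp (Suc n) (b (Suc n) p (Suc (Suc n)) f) = f"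
proof (rule C_eqI[OF cmap_in[OF cmap_row_htp cmap_in[OF cmap_b f]] f])
  fix m and as :: "'a list" assume as: "length as = Suc n"
  have "row_htp (Suc n) (b (Suc n) p (Suc (Suc n)) f) (tens sM sA m as) =
      sweedler2 sM sA (\<rho>M m) (\<lambda>m0 m1. f (tens sM sA (actM m1 (M.P m0)) as))"
    using as by (simp add: row_htp_tens[OF cmap_in[OF cmap_b f]] b_tens[OF f] b_body_def nth_append)
  also have "\<dots> = f (tens sM sA (sweedler2 sM sA (\<rho>M m) (\<lambda>m0 m1. actM m1 (M.P m0))) as)"
    by (rule sweedler2_push_lin[OF M.vsM M.vsA lin_C_left[OF f as lin_id] M.coact_in, symmetric])
  finally show "row_htp (Suc n) (b (Suc n) p (Suc (Suc n)) f) (tens sM sA m as) = f (tens sM sA m as)"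
    by (simp add: M.P_decomp)
qed

text \<open>The last face has index n + 2, hence the sign (-1)^n in front of f; the remaining faces
  keep their index and sign.\<close>

lemma row_htp_d_m:
  assumes f: "f \<in> C (Suc n) p"
  shows "row_htp (Suc n) (d_m (Suc n) p f) = d_m n p (row_htp n f) + alt n f"
proof -
  have "row_htp (Suc n) (d_m (Suc n) p f) =
      (\<Sum>i = 0..Suc (Suc n). alt i (row_htp (Suc n) (b (Suc n) p i f)))"
    unfolding d_m_def Suc_eq_plus1[symmetric]
    by (rule cmap_push_alt_sum[OF cmap_row_htp cmap_in[OF cmap_b f]])
  also have "\<dots> = (\<Sum>i = 0..Suc n. alt i (row_htp (Suc n) (b (Suc n) p i f))) +
      alt (Suc (Suc n)) (row_htp (Suc n) (b (Suc n) p (Suc (Suc n)) f))"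
    by (rule sum.atLeast0_atMost_Suc)
  also have "\<dots> = (\<Sum>i = 0..Suc n. alt i (b n p i (row_htp n f))) + alt n f"
    by (intro arg_cong2[where f = plus] sum.cong)
      (simp_all add: row_htp_b[OF f] row_htp_b_last[OF f] alt_def)
  finally show ?thesis
    by (simp only: d_m_def Suc_eq_plus1[symmetric])
qed

section \<open>The defect \<omega> of the column homotopy on the edge p = 0\<close>

definition weight :: "'a \<Rightarrow> ('k, 'n, 'a) tensor \<Rightarrow> ('k, 'n, 'a) tensor" where
  "weight z t = retract 0 (append_T 0 z t)"

lemma tlin_weight: "tlin sN sA 0 tscale (weight z)"
  unfolding weight_def[abs_def]
  by (rule tlin_tlin[OF _ tlin_append_T append_T_in]) (use tlin_retract[of 0] in simp)

lemma weight_in: "t \<in> T_N 0 \<Longrightarrow> weight z t \<in> T_N 0"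
  unfolding weight_def by (intro retract_in append_T_in)

text \<open>With this formula \<open>col_proj\<close> is seen to send f to x \<mapsto> \<Sum> x_1
  \<cdot> P(f(x_0)), where x_0 \<otimes> x_1 is the diagonal coaction on A^n \<otimes> M.\<close>

lemma weight_tens: "weight z (tens sN sA y []) = tens sN sA (actN z (N.P y)) []"
  by (simp add: weight_def append_T_tens retract_tens)

lemma lin_weight: "t \<in> T_N 0 \<Longrightarrow> lin s sA g \<Longrightarrow> lin s tscale (\<lambda>x. weight (g x) t)"
  unfolding weight_def
  by (rule lin_tlin[OF tlin_retract lin_append_T append_T_in])

lemma weight_mult:
  assumes "t \<in> T_N 0"
  shows "weight (a * z) t = act_T 0 a (weight z t)"
proof (rule tlin_eqI[OF N.vsM M.vsA tlin_weight tlin_tlin[OF tlin_act_T tlin_weight weight_in] assms])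
  fix y and ys :: "'a list" assume "length ys = 0"
  then show "weight (a * z) (tens sN sA y ys) = act_T 0 a (weight z (tens sN sA y ys))"
    by (simp add: weight_tens act_T_0 N.act_mult)
qed

text \<open>On y in N the left side is \<Sum> a_2 z \<cdot> P(a_1 \<cdot> y), where P(a_1 \<cdot> y)
  = \<epsilon>(a_1) P y. With \<open>weight_mult\<close> this makes \<omega> commute with
  b_0.\<close>

lemma weight_act_T:
  assumes "t \<in> T_N 0"
  shows "sweedler2 sA sA (\<Delta> a) (\<lambda>a1 a2. weight (a2 * z) (act_T 0 a1 t)) = weight (a * z) t"
proof (rule tlin_eqI[OF N.vsM M.vsA _ tlin_weight assms])
  show "tlin sN sA 0 tscale (\<lambda>t. sweedler2 sA sA (\<Delta> a) (\<lambda>a1 a2. weight (a2 * z) (act_T 0 a1 t)))"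
    by (intro tlin_sweedler2_fun[OF M.vsA M.vsA vector_space_tscale M.comult_in] tlin_tlin[OF tlin_weight tlin_act_T act_T_in])
  fix y and ys :: "'a list" assume "length ys = 0"
  moreover have "tens sN sA (actN x (sN k v)) [] = tscale k (tens sN sA (actN x v) [])" for k x v
    using lin_tens[OF N.vsM M.vsA N.lin_act_right[OF lin_id], of x "[]"]
    by (simp add: lin_def)
  moreover have "lin sA tscale (\<lambda>a2. tens sN sA (actN (a2 * z) (N.P y)) [])"
    by (intro lin_tens N.vsM M.vsA N.lin_act_left M.lin_mult_left lin_id)
  ultimately show "sweedler2 sA sA (\<Delta> a) (\<lambda>a1 a2. weight (a2 * z) (act_T 0 a1 (tens sN sA y ys))) = weight (a * z) (tens sN sA y ys)"
    by (simp add: weight_tens act_T_0 N.P_act M.sweedler2_counit_left[OF vector_space_tscale])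
qed

text \<open>Coinvariance of P y: the coaction of z \<cdot> P y only comultiplies z.\<close>

lemma coface_weight:
  assumes "t \<in> T_N 0"
  shows "coface 0 0 (weight z t) = sweedler2 sA sA (\<Delta> z) (\<lambda>u v. append_T 0 v (weight u t))"
proof (rule tlin_eqI[OF N.vsM M.vsA tlin_tlin[OF tlin_coface tlin_weight weight_in] _ assms])
  show "tlin sN sA 0 tscale (\<lambda>t. sweedler2 sA sA (\<Delta> z) (\<lambda>u v. append_T 0 v (weight u t)))"
    by (intro tlin_sweedler2_fun[OF M.vsA M.vsA vector_space_tscale M.comult_in] tlin_tlin[OF tlin_append_T tlin_weight weight_in])
  fix y and ys :: "'a list" assume ys: "length ys = 0"
  have "sweedler2 sN sA (\<rho>N (actN z (N.P y))) (\<lambda>y0 y1. tens sN sA y0 [y1]) =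
      sweedler2 sA sA (\<Delta> z) (\<lambda>u w. sweedler2 sN sA (\<rho>N (N.P y)) (\<lambda>v0 v1.
        tens sN sA (actN u v0) [w * v1]))"
    by (intro N.sweedler2_hopf_compat[OF vector_space_tscale] lin_tens lin_tens_Cons N.vsM M.vsA lin_id)
  also have "\<dots> = sweedler2 sA sA (\<Delta> z) (\<lambda>u w. tens sN sA (actN u (N.P y)) [w])"
    by (subst N.P_coinvariant[OF vector_space_tscale])
      (auto intro!: lin_tens lin_tens_Cons N.vsM M.vsA N.lin_act_right M.lin_mult_right lin_id)
  finally show "coface 0 0 (weight z (tens sN sA y ys)) =
      sweedler2 sA sA (\<Delta> z) (\<lambda>u v. append_T 0 v (weight u (tens sN sA y ys)))"
    using ys by (simp add: weight_tens coface_tens append_T_tens)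
qed simp

definition col_proj :: "nat \<Rightarrow> (('k, 'm, 'a) tensor \<Rightarrow> ('k, 'n, 'a) tensor) \<Rightarrow> ('k, 'm, 'a) tensor \<Rightarrow> ('k, 'n, 'a) tensor"
  where "col_proj n f = col_htp 0 (c n 0 1 f)"

lemma cmap_col_proj: "cmap n 0 n 0 (col_proj n)"
  unfolding col_proj_def[abs_def] One_nat_def
  by (rule cmap_comp[OF cmap_col_htp cmap_c_last])

lemma col_proj_tens:
  assumes f: "f \<in> C n 0" and as: "length as = n"
  shows "col_proj n f (tens sM sA m as) = diag_sum as m (\<lambda>xs m0 z. weight z (f (tens sM sA m0 xs)))"
  unfolding col_proj_def One_nat_def
  by (simp add: col_htp_def c_last_tens[OF f as] diag_sum_push[OF tlin_retract] append_T_in C_in[OF f] weight_def)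

lemma col_htp_d_c_0:
  assumes f: "f \<in> C n 0"
  shows "col_htp 0 (d_c n 0 f) = f - col_proj n f"
proof -
  have "col_htp 0 (c n 0 0 f - c n 0 (Suc 0) f) = col_htp 0 (c n 0 0 f) - col_htp 0 (c n 0 (Suc 0) f)"
    by (rule cmap_diff[OF cmap_col_htp[of n]]) (use cmap_in[OF cmap_c_all f] in simp_all)
  then show ?thesis
    using col_htp_c_0[OF f] by (simp add: d_c_def alt_def col_proj_def del: minus_apply)
qed

lemma diag_multilinear_weight:
  assumes f: "f \<in> C n 0"
  shows "diag_multilinear n (\<lambda>xs m0 z. weight z (f (tens sM sA m0 xs)))"
  unfolding diag_multilinear_def
  by (auto intro!: lin_weight lin_id lin_tlin[OF tlin_weight] lin_C_left[OF f] lin_C_update[OF f] C_in[OF f])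

text \<open>The three kinds of face rest on three facts: b_0 on P absorbing the action through
  \<epsilon>, the inner faces on multiplicativity of \<Delta>, and the last face on the Hopf
  condition of M.\<close>

lemma col_proj_b:
  assumes f: "f \<in> C n 0" and i: "i \<le> Suc n"
  shows "col_proj (Suc n) (b n 0 i f) = b n 0 i (col_proj n f)"
proof -
  note w = cmap_in[OF cmap_col_proj f]
  show ?thesis
  proof (rule C_eqI[OF cmap_in[OF cmap_col_proj cmap_in[OF cmap_b f]] cmap_in[OF cmap_b w]])
    fix m and as :: "'a list" assume as: "length as = Suc n"
    have "col_proj (Suc n) (b n 0 i f) (tens sM sA m as) =
        diag_sum as m (\<lambda>xs m0 z. weight z (b n 0 i f (tens sM sA m0 xs)))"
      by (rule col_proj_tens[OF cmap_in[OF cmap_b f] as])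
    also have "\<dots> = diag_sum as m (\<lambda>xs m0 z. weight z (b_body n 0 i f m0 xs))"
      by (rule diag_sum_cong) (simp add: b_tens[OF f] as)
    also have "\<dots> = b_body n 0 i (col_proj n f) m as"
    proof -
      consider "i = 0" | "0 < i" "i \<le> n" | "i = Suc n" using i by linarith
      then show ?thesis
      proof cases
        case 1
        obtain a as' where a: "as = a # as'" "length as' = n" using as by (cases as) auto
        have "diag_sum as m (\<lambda>xs m0 z. weight z (act_T 0 (xs ! 0) (f (tens sM sA m0 (tl xs))))) =
            diag_sum as' m (\<lambda>xs m0 z. sweedler2 sA sA (\<Delta> a) (\<lambda>a1 a2. weight (a2 * z) (act_T 0 a1 (f (tens sM sA m0 xs)))))"
          by (simp add: a sweedler2_diag_sum_swap)
        also have "\<dots> = diag_sum as' m (\<lambda>xs m0 z. act_T 0 a (weight z (f (tens sM sA m0 xs))))"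
          by (simp add: weight_act_T weight_mult C_in[OF f])
        also have "\<dots> = act_T 0 a (diag_sum as' m (\<lambda>xs m0 z. weight z (f (tens sM sA m0 xs))))"
          by (rule diag_sum_push[OF tlin_act_T, symmetric]) (intro weight_in C_in[OF f])
        finally show ?thesis using 1 a by (simp add: b_body_def col_proj_tens[OF f])
      next
        case 2
        moreover have "length (merge (i - 1) as) = n" using 2 as by (simp add: merge_def)
        ultimately show ?thesis
          using diag_sum_merge[of "i - 1" as, OF _ ] diag_multilinear_weight[OF f] as
          by (simp add: b_body_def col_proj_tens[OF f])
      next
        case 3
        define bs where "bs = take n as"
        have bs: "as = bs @ [as ! n]" "length bs = n"
          using as by (simp_all add: bs_def flip: take_Suc_conv_app_nth)
        have "diag_sum bs (actM (as ! n) m) (\<lambda>xs m0 z. weight z (f (tens sM sA m0 xs))) =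
            diag_sum (bs @ [as ! n]) m (\<lambda>xs m0 z. weight z (f (tens sM sA (actM (xs ! n) m0) (take n xs))))"
          by (subst diag_sum_act) (simp_all add: bs(2) diag_multilinear_weight[OF f])
        with 3 bs show ?thesis by (simp add: b_body_def col_proj_tens[OF f] flip: bs_def)
      qed
    qed
    finally show "col_proj (Suc n) (b n 0 i f) (tens sM sA m as) = b n 0 i (col_proj n f) (tens sM sA m as)"
      by (simp only: b_tens[OF w as])
  qed
qed

lemma col_proj_d_m:
  assumes f: "f \<in> C n 0"
  shows "col_proj (Suc n) (d_m n 0 f) = d_m n 0 (col_proj n f)"
  unfolding d_m_def
  by (subst cmap_push_alt_sum[OF cmap_col_proj cmap_in[OF cmap_b f]])
    (simp add: col_proj_b[OF f])

text \<open>For p = 0 the differential is c_0 - c_1, so the claim is colinearity of \<omega> f.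
  Coacting on x_1 \<cdot> P(f(x_0)) comultiplies x_1, and coassociativity of the diagonal coaction
  moves this to a second coaction on x_0, which is c_1.\<close>

lemma d_c_col_proj:
  assumes f: "f \<in> C n 0"
  shows "d_c n 0 (col_proj n f) = 0"
proof -
  note w = cmap_in[OF cmap_col_proj f]
  have "c n 0 0 (col_proj n f) = c n 0 (Suc 0) (col_proj n f)"
  proof (rule C_eqI[OF cmap_in[OF cmap_c_all w] cmap_in[OF cmap_c_all w]])
    fix m and as :: "'a list" assume as: "length as = n"
    have "c n 0 0 (col_proj n f) (tens sM sA m as) =
        coface 0 0 (diag_sum as m (\<lambda>xs m0 z. weight z (f (tens sM sA m0 xs))))"
      by (simp add: c_eq_coface col_proj_tens[OF f as])
    also have "\<dots> = diag_sum as m (\<lambda>xs m0 z. coface 0 0 (weight z (f (tens sM sA m0 xs))))"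
      by (rule diag_sum_push[OF tlin_coface]) (auto intro: weight_in C_in[OF f])
    also have "\<dots> = diag_sum as m (\<lambda>xs m0 z. sweedler2 sA sA (\<Delta> z) (\<lambda>u v. append_T 0 v (weight u (f (tens sM sA m0 xs)))))"
      by (simp add: coface_weight C_in[OF f])
    also have "\<dots> = diag_sum as m (\<lambda>xs m0 z'. diag_sum xs m0 (\<lambda>xs' m' z. append_T 0 z' (weight z (f (tens sM sA m' xs')))))"
    proof (rule diag_sum_coassoc[symmetric])
      show "diag_multilinear (length as) (\<lambda>xs m z. append_T 0 z' (weight z (f (tens sM sA m xs))))" for z'
        unfolding diag_multilinear_def
        by (auto intro!: lin_tlin[OF tlin_append_T] weight_in C_in[OF f] lin_weight lin_id lin_tlin[OF tlin_weight]
            lin_C_left[OF f] lin_C_update[OF f] simp: as)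
    qed (intro lin_append_T lin_id)
    also have "\<dots> = diag_sum as m (\<lambda>xs m0 z'. append_T 0 z' (diag_sum xs m0 (\<lambda>xs' m' z. weight z (f (tens sM sA m' xs')))))"
      by (simp add: diag_sum_push[OF tlin_append_T] weight_in C_in[OF f])
    also have "\<dots> = diag_sum as m (\<lambda>xs m0 z'. append_T 0 z' (col_proj n f (tens sM sA m0 xs)))"
      by (rule diag_sum_cong) (simp add: col_proj_tens[OF f] as)
    also have "\<dots> = c n 0 (Suc 0) (col_proj n f) (tens sM sA m as)"
      by (rule c_last_tens[OF w as, symmetric])
    finally show "c n 0 0 (col_proj n f) (tens sM sA m as) = c n 0 (Suc 0) (col_proj n f) (tens sM sA m as)" .
  qed simp_all
  then show ?thesis by (simp add: d_c_def alt_def)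
qed

section \<open>Assembling the primitive of a cocycle\<close>

lemma cocycle_imp_coboundary:
  assumes F: "F \<in> tot (Suc q)" and dF: "tot_d (Suc q) F = 0"
  shows "\<exists>G\<in>tot q. tot_d q G = F"
proof -
  have FC: "F n \<in> C n (Suc q - n)" for n by (rule tot_C[OF F])
  have FC': "F n \<in> C n (Suc (q - n))" if "n \<le> q" for n
    using FC[of n] that by (simp add: Suc_diff_le)
  have F_top: "F (Suc q) \<in> C (Suc q) 0" using FC[of "Suc q"] by simp
  define d where "d n = d_c n (Suc q - n) (F n)" for n
  have d_0: "d 0 = 0"
    using fun_cong[OF dF, of 0] by (simp add: tot_d_def d_def alt_def)
  \<comment> \<open>Component k + 1 of the cocycle equation, with the sign (-1)^{k+1} of d_c carried
    to the other side.\<close>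
  have d_Suc: "d_m k (Suc q - k) (F k) = alt k (d (Suc k))" if "k \<le> q" for k
  proof -
    have "d_m k (Suc q - k) (F k) + alt (Suc k) (d (Suc k)) = 0"
      using fun_cong[OF dF, of "Suc k"] that by (simp add: tot_d_def d_def)
    then show ?thesis by (simp add: alt_Suc)
  qed
  have d_top: "d_m (Suc q) 0 (F (Suc q)) = 0"
    using fun_cong[OF dF, of "Suc (Suc q)"] by (simp add: tot_d_def)
  have dC: "d n \<in> C n (Suc (Suc q - n))" for n
    unfolding d_def by (rule cmap_in[OF cmap_d_c FC])

  \<comment> \<open>The sign (-1)^n cancels the one that the total differential puts before d_c, and
    also the one in \<open>d_Suc\<close>.\<close>
  define G where "G n = (if n \<le> q then alt n (col_htp (q - n) (F n)) else 0)" for n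
  have G: "G \<in> tot q"
    using cmap_in[OF cmap_col_htp FC'] by (auto simp: tot_def G_def intro!: alt_in_C)
  \<comment> \<open>Since d_m F_{q+1} = 0, the homotopy relation gives d_m s F_{q+1} = (-1)^{q+1}
    F_{q+1}; the sign is chosen so that d_m \<kappa> = \<omega> F_{q+1}.\<close>
  define \<kappa> where "\<kappa> = alt (Suc q) (col_proj q (row_htp q (F (Suc q))))"
  have row: "row_htp q (F (Suc q)) \<in> C q 0" by (rule cmap_in[OF cmap_row_htp F_top])
  have proj: "col_proj q (row_htp q (F (Suc q))) \<in> C q 0" by (rule cmap_in[OF cmap_col_proj row])
  have \<kappa>: "\<kappa> \<in> C q 0"
    unfolding \<kappa>_def by (rule alt_in_C[OF proj])
  define K where "K n = (if n = q then \<kappa> else 0)" for n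
  have K: "K \<in> tot q"
    using \<kappa> by (auto simp: tot_def K_def zero_in_C)

  have dm_G: "d_m k (q - k) (G k) = col_htp (q - k) (d (Suc k))" if "k \<le> q" for k
  proof -
    have dk: "d (Suc k) \<in> C (Suc k) (Suc (q - k))" using dC[of "Suc k"] by simp
    have "d_m k (q - k) (G k) = alt k (d_m k (q - k) (col_htp (q - k) (F k)))"
      using cmap_alt[OF cmap_d_m cmap_in[OF cmap_col_htp FC'[OF that]]] that by (simp add: G_def)
    also have "\<dots> = alt k (col_htp (q - k) (d_m k (Suc q - k) (F k)))"
      using col_htp_d_m[OF FC'[OF that]] that by (simp add: Suc_diff_le)
    also have "\<dots> = alt k (alt k (col_htp (q - k) (d (Suc k))))"
      using cmap_alt[OF cmap_col_htp dk, of k] by (simp only: d_Suc[OF that])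
    finally show ?thesis by (simp only: alt_alt)
  qed
  have dc_G: "alt n (d_c n (q - n) (G n)) = F n - col_htp (Suc q - n) (d n)" if "n \<le> q" for n
  proof -
    have "alt n (d_c n (q - n) (G n)) = alt n (alt n (d_c n (q - n) (col_htp (q - n) (F n))))"
      using cmap_alt[OF cmap_d_c cmap_in[OF cmap_col_htp FC'[OF that]], of n] that by (simp add: G_def)
    also have "\<dots> = F n - col_htp (Suc (q - n)) (d_c n (Suc (q - n)) (F n))"
      using col_htp_d_c[OF FC'[OF that]] by (simp only: alt_alt) (simp add: algebra_simps)
    finally show ?thesis using that by (simp add: d_def Suc_diff_le)
  qed
  have dm_K: "d_m q 0 \<kappa> = col_proj (Suc q) (F (Suc q))"
  proof -
    have "d_m q 0 (row_htp q (F (Suc q))) + alt q (F (Suc q)) = 0"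
      using row_htp_d_m[OF F_top] cmap_0[OF cmap_row_htp[of "Suc q" 0]] by (simp only: d_top)
    then have *: "d_m q 0 (row_htp q (F (Suc q))) = alt (Suc q) (F (Suc q))"
      by (simp add: alt_Suc eq_neg_iff_add_eq_0)
    have "d_m q 0 \<kappa> = alt (Suc q) (d_m q 0 (col_proj q (row_htp q (F (Suc q)))))"
      unfolding \<kappa>_def by (rule cmap_alt[OF cmap_d_m proj])
    also have "\<dots> = alt (Suc q) (col_proj (Suc q) (alt (Suc q) (F (Suc q))))"
      by (simp only: col_proj_d_m[OF row, symmetric] *)
    also have "\<dots> = col_proj (Suc q) (F (Suc q))"
      by (simp only: cmap_alt[OF cmap_col_proj F_top] alt_alt)
    finally show ?thesis .
  qed
  have dc_K: "d_c q 0 \<kappa> = 0"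
    unfolding \<kappa>_def by (simp only: cmap_alt[OF cmap_d_c proj] d_c_col_proj[OF row] alt_zero)

  \<comment> \<open>The sum of \<open>dm_G\<close> at n - 1 and \<open>dc_G\<close> at n telescopes:
    t d_c F_n enters with both signs. At n = 0 only \<open>dc_G\<close> is present, and d_c F_0 = 0.
    At n = q + 1 only \<open>dm_G\<close> is present and gives F_n - \<omega> F_n, which K
    completes.\<close>
  have "tot_d q (G + K) n = F n" for n
  proof -
    have K_n: "tot_d q K n = (if n = Suc q then col_proj (Suc q) (F (Suc q)) else 0)"
      using dm_K dc_K cmap_0[OF cmap_d_m] cmap_0[OF cmap_d_c]
      by (auto simp: tot_d_def K_def alt_zero)
    consider "n = 0" | k where "n = Suc k" "n \<le> q" | "n = Suc q" | "n > Suc q"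
      by (metis Suc_lessI less_Suc_eq_le not0_implies_Suc not_le)
    then have "tot_d q G n = (if n = Suc q then F n - col_proj (Suc q) (F (Suc q)) else F n)"
    proof cases
      case 1
      have "tot_d q G 0 = alt 0 (d_c 0 (q - 0) (G 0))" by (simp add: tot_d_def)
      also have "\<dots> = F 0 - col_htp (Suc q - 0) (d 0)" by (rule dc_G) simp
      also have "\<dots> = F 0" by (simp only: d_0 cmap_0[OF cmap_col_htp] diff_zero)
      finally show ?thesis using 1 by simp
    next
      case (2 k)
      have "tot_d q G n = d_m k (q - k) (G k) + alt n (d_c n (q - n) (G n))"
        using 2 by (simp add: tot_d_def)
      also have "\<dots> = F n"
        using 2 dm_G[of k] dc_G[of n] by simp
      finally show ?thesis using 2 by simp
    next
      case 3
      have "tot_d q G n = d_m q 0 (G q)" using 3 by (simp add: tot_d_def)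
      also have "\<dots> = col_htp 0 (d (Suc q))" using dm_G[of q] by simp
      also have "\<dots> = F (Suc q) - col_proj (Suc q) (F (Suc q))"
        using col_htp_d_c_0[OF F_top] by (simp add: d_def)
      finally show ?thesis using 3 by simp
    next
      case 4
      then show ?thesis using F by (simp add: tot_d_def tot_def)
    qed
    then show ?thesis
      using K_n by (simp add: tot_d_add[OF G K])
  qed
  then show ?thesis using tot_add[OF G K] by blast
qed

text \<open>Every cocycle is a coboundary, so its coset is the group of coboundaries itself.\<close>

lemma cohomology_eq:
  assumes "n \<ge> 1"
  shows "cohomology n = {coboundaries n}"
proof -
  obtain q where n: "n = Suc q" using assms by (cases n) auto
  have cob: "coboundaries n = tot_d q ` tot q" by (simp add: coboundaries_def n)
  have "{F + G | G. G \<in> coboundaries n} = coboundaries n" if F: "F \<in> cocycles n" for F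
  proof -
    obtain G where G: "G \<in> tot q" "tot_d q G = F"
      using cocycle_imp_coboundary[of F q] F by (auto simp: cocycles_def n)
    have "F + tot_d q H \<in> tot_d q ` tot q" if "H \<in> tot q" for H
      using tot_d_add[OF G(1) that] G tot_add[OF G(1) that] by (metis image_eqI)
    moreover have "\<exists>H\<in>tot_d q ` tot q. tot_d q K = F + H" if "K \<in> tot q" for K
    proof -
      have "F + tot_d q (K + - G) = tot_d q K"
        using tot_d_add[OF that tot_uminus[OF G(1)]] tot_d_uminus[OF G(1)] G(2)
        by (simp only:) (simp add: algebra_simps)
      then show ?thesis using tot_add[OF that tot_uminus[OF G(1)]] by (metis image_eqI)
    qed
    ultimately show ?thesis unfolding cob by blast
  qed
  \<comment> \<open>Guarantees that there is at least one class, so that the set of cosets is a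
    singleton and not empty.\<close>
  moreover have "0 \<in> cocycles n"
    by (simp add: cocycles_def tot_0 tot_d_0)
  ultimately show ?thesis unfolding cohomology_def by auto
qed

end

theorem proposition6:
  fixes sA :: "'k::field \<Rightarrow> 'a::ring_1 \<Rightarrow> 'a"
    and \<Delta> :: "'a \<Rightarrow> ('k, 'a, 'a) tensor" and \<epsilon> :: "'a \<Rightarrow> 'k"
    and sM :: "'k \<Rightarrow> 'm::ab_group_add \<Rightarrow> 'm"
    and actM :: "'a \<Rightarrow> 'm \<Rightarrow> 'm" and \<rho>M :: "'m \<Rightarrow> ('k, 'm, 'a) tensor"
    and sN :: "'k \<Rightarrow> 'n::ab_group_add \<Rightarrow> 'n"
    and actN :: "'a \<Rightarrow> 'n \<Rightarrow> 'n" and \<rho>N :: "'n \<Rightarrow> ('k, 'n, 'a) tensor"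
    and n :: nat
  assumes "bialgebra sA \<Delta> \<epsilon>"
    and "\<exists>S. skew_antipode sA \<Delta> \<epsilon> S"
    and "hopf_module sA \<Delta> \<epsilon> sM actM \<rho>M"
    and "hopf_module sA \<Delta> \<epsilon> sN actN \<rho>N"
    and "n \<ge> 1"
  shows "hopf_complex.cohomology sA \<Delta> sM actM \<rho>M sN actN \<rho>N n =
    {hopf_complex.coboundaries sA \<Delta> sM actM \<rho>M sN actN \<rho>N n}"
proof -
  obtain S where "skew_antipode sA \<Delta> \<epsilon> S" using assms(2) by blast
  then interpret skew_hopf_complex sA \<Delta> \<epsilon> sM actM \<rho>M sN actN \<rho>N S
    using assms(3,4) by (simp add: skew_hopf_complex_def hopf_complex_def skew_hopf_complex_axioms_def)
  show ?thesis by (rule cohomology_eq[OF assms(5)])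
qed

end
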